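(* Let $n\ge 1$. The function $\eta=\eta(z,\tau)$ is a theta function of order $n+1$ and weight $(n+5)/2$ on the theta divisor. That is: (i) For any fixed $\tau\in\mathbb{H}_n$, the function $\eta(\cdot,\tau)$, restricted to the zero locus of $\theta(\cdot,\tau)$ in $\mathbb{C}^n$, gives rise to a global section of the line bundle $O_\Theta(\Theta)^{\otimes n+1}$ on $\Theta\subset A=\mathbb{C}^n/(\mathbb{Z}^n+\tau\mathbb{Z}^n)$; explicitly, for all $u,v\in\mathbb{Z}^n$ and all $z\in\mathbb{C}^n$ with $\theta(z,\tau)=0$, $$\eta(z+\tau u+v,\tau)=\left(e^{-\pi i\,{}^tu\tau u-2\pi i\,{}^tuz}\right)^{n+1}\eta(z,\tau).$$ (ii) As a function of the two variables $(z,\tau)$, $\eta$ transforms under the action of $\Gamma_{1,2}$ with automorphy factor $\det(c\tau+d)^{(n+5)/2}$ on $\theta^{-1}(0)$; explicitly, for every $\gamma=\begin{pmatrix}a&b\\c&d\end{pmatrix}\in\Gamma_{1,2}$ and every $(z,\tau)\in\mathbb{C}^n\times\mathbb{H}_n$ with $\theta(z,\tau)=0$, $$\eta\left({}^t(c\tau+d)^{-1}z,(a\tau+b)(c\tau+d)^{-1}\right)=\zeta_\gamma^{n+1}\det(c\tau+d)^{(n+5)/2}\left(e^{\pi i\,{}^tz(c\tau+d)^{-1}cz}\right)^{n+1}\eta(z,\tau),$$ where $\zeta_\gamma$ is the 8th root of unity occurring in the transformation formula of $\theta$ under $\gamma$.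
   Context: $\mathbb{H}_n$ is the Siegel upper half space of degree $n$; vectors are column vectors and ${}^t$ denotes transpose. The Riemann theta function on $\mathbb{C}^n\times\mathbb{H}_n$ is $\theta(z,\tau)=\sum_{m\in\mathbb{Z}^n}e^{\pi i\,{}^tm\tau m+2\pi i\,{}^tmz}$. For fixed $\tau$ it satisfies $\theta(z+\tau u+v)=e^{-\pi i\,{}^tu\tau u-2\pi i\,{}^tuz}\theta(z)$ for $u,v\in\mathbb{Z}^n$, so $\Theta=\mathrm{div}\,\theta$ is a well-defined divisor on the complex torus $A=\mathbb{C}^n/(\mathbb{Z}^n+\tau\mathbb{Z}^n)$, and $\theta$ gives a global section of $O_A(\Theta)$. A theta function of order $k$ on $\Theta$ is a function on the zero locus of $\theta(\cdot,\tau)$ in $\mathbb{C}^n$ which transforms under $z\mapsto z+\tau u+v$ with the $k$-th power of this factor. $\Gamma_{1,2}$ is the group of matrices $\gamma=\begin{pmatrix}a&b\\c&d\end{pmatrix}\in\mathrm{Sp}(2n,\mathbb{Z})$ ($a,b,c,d$ of size $n\times n$) such that the diagonals of ${}^tac$ and ${}^tbd$ consist of even integers. It acts on $\mathbb{C}^n\times\mathbb{H}_n$ by $(z,\tau)\mapsto({}^t(c\tau+d)^{-1}z,(a\tau+b)(c\tau+d)^{-1})$, and one has (known fact) $$\theta({}^t(c\tau+d)^{-1}z,(a\tau+b)(c\tau+d)^{-1})=\zeta_\gamma\det(c\tau+d)^{1/2}e^{\pi i\,{}^tz(c\tau+d)^{-1}cz}\theta(z,\tau)$$ for some 8th root of unity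 $\zeta_\gamma$ (relative to a chosen branch of $\det(c\tau+d)^{1/2}$; half-integer powers of $\det(c\tau+d)$ are powers of that same branch). Write $\theta_i=\partial\theta/\partial z_i$ and $\theta_{ij}=\partial^2\theta/\partial z_i\partial z_j$. For a square matrix $(h_{ij})$, $(h_{ij})^c=(h^c_{ij})$ denotes the cofactor matrix, $h^c_{ij}=(-1)^{i+j}\det(h_{kl})_{k\ne i,l\ne j}$ (equal to $(1)$ for a $1\times1$ matrix). Then $$\eta=\eta(z,\tau)={}^t(\theta_i)\,(\theta_{ij})^c\,(\theta_j),$$ considered as a function on the vanishing locus $\theta^{-1}(0)\subset\mathbb{C}^n\times\mathbb{H}_n$. *)

theory Defs
  imports
    "HOL-Complex_Analysis.Complex_Analysis"
    "Jordan_Normal_Form.Determinant"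
    "Jordan_Normal_Form.Gauss_Jordan_Elimination"
begin

unbundle no inner_syntax
unbundle no vec_syntax
hide_const (open) Finite_Cartesian_Product.mat Finite_Cartesian_Product.vec
  Finite_Cartesian_Product.row Finite_Cartesian_Product.rows Determinants.det

abbreviation cvec :: "int Matrix.vec \<Rightarrow> complex Matrix.vec"
  where "cvec \<equiv> map_vec of_int"

abbreviation cmat :: "int Matrix.mat \<Rightarrow> complex Matrix.mat"
  where "cmat \<equiv> map_mat of_int"

text \<open>Bilinear, without complex conjugation: \<open>quad A x\<close> is the scalar ${}^t x A x$.\<close>

abbreviation quad :: "'a::comm_ring_1 Matrix.mat \<Rightarrow> 'a Matrix.vec \<Rightarrow> 'a"
  where "quad A x \<equiv> x \<bullet> (A *\<^sub>v x)"

definition siegel_space :: "nat \<Rightarrow> complex Matrix.mat set" where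
  "siegel_space n =
     {\<tau> \<in> carrier_mat n n. transpose_mat \<tau> = \<tau> \<and>
        (\<forall>x \<in> carrier_vec n. x \<noteq> 0\<^sub>v n \<longrightarrow> quad (map_mat Im \<tau>) x > 0)}"

definition riemann_theta :: "nat \<Rightarrow> complex Matrix.vec \<Rightarrow> complex Matrix.mat \<Rightarrow> complex" where
  "riemann_theta n z \<tau> =
     (\<Sum>\<^sub>\<infinity>m \<in> carrier_vec n. exp (pi * \<i> * quad \<tau> (cvec m) + 2 * pi * \<i> * (cvec m \<bullet> z)))"


subsection \<open>Complex analysis on $\mathbf{C}^n$\<close>

definition cpartial ::
    "nat \<Rightarrow> nat \<Rightarrow> (complex Matrix.vec \<Rightarrow> complex) \<Rightarrow> complex Matrix.vec \<Rightarrow> complex" where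
  "cpartial n i F z = deriv (\<lambda>w. F (z + w \<cdot>\<^sub>v unit_vec n i)) 0"

text \<open>
  Vectors and matrices of variable size carry no topology here, so continuity is stated for the
  coordinate functions: \<open>Matrix.vec n x\<close> and \<open>Matrix.mat n n x\<close> depend only on the first
  \<open>n\<close> (respectively \<open>n \<times> n\<close>) coordinates of \<open>x\<close>, and the function space carries the
  product topology. A function on $\mathbf{C}^n$ is holomorphic if it is continuous and
  holomorphic in each variable separately.
\<close>

definition holomorphic_Cn :: "nat \<Rightarrow> (complex Matrix.vec \<Rightarrow> complex) \<Rightarrow> bool" where
  "holomorphic_Cn n F \<longleftrightarrow>
     continuous_on UNIV (\<lambda>x :: nat \<Rightarrow> complex. F (Matrix.vec n x)) \<and>
     (\<forall>z \<in> carrier_vec n. \<forall>i < n. (\<lambda>w. F (z + w \<cdot>\<^sub>v unit_vec n i)) holomorphic_on UNIV)"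

definition continuous_on_siegel :: "nat \<Rightarrow> (complex Matrix.mat \<Rightarrow> complex) \<Rightarrow> bool" where
  "continuous_on_siegel n s \<longleftrightarrow>
     continuous_on {x :: nat \<times> nat \<Rightarrow> complex. Matrix.mat n n x \<in> siegel_space n}
       (\<lambda>x. s (Matrix.mat n n x))"


subsection \<open>The function $\eta$\<close>

definition theta_grad :: "nat \<Rightarrow> complex Matrix.vec \<Rightarrow> complex Matrix.mat \<Rightarrow> complex Matrix.vec" where
  "theta_grad n z \<tau> = Matrix.vec n (\<lambda>i. cpartial n i (\<lambda>z. riemann_theta n z \<tau>) z)"

definition theta_hess :: "nat \<Rightarrow> complex Matrix.vec \<Rightarrow> complex Matrix.mat \<Rightarrow> complex Matrix.mat" where
  "theta_hess n z \<tau> =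
     Matrix.mat n n (\<lambda>(i, j). cpartial n i (cpartial n j (\<lambda>z. riemann_theta n z \<tau>)) z)"

text \<open>Not transposed, in contrast to \<^const>\<open>adj_mat\<close>.\<close>

definition cofactor_mat :: "'a::comm_ring_1 Matrix.mat \<Rightarrow> 'a Matrix.mat" where
  "cofactor_mat A = Matrix.mat (dim_row A) (dim_col A) (\<lambda>(i, j). cofactor A i j)"

definition eta :: "nat \<Rightarrow> complex Matrix.vec \<Rightarrow> complex Matrix.mat \<Rightarrow> complex" where
  "eta n z \<tau> = quad (cofactor_mat (theta_hess n z \<tau>)) (theta_grad n z \<tau>)"


subsection \<open>The group $\Gamma_{1,2}$ and its action\<close>

definition symplectic_form :: "nat \<Rightarrow> int Matrix.mat" where
  "symplectic_form n = four_block_mat (0\<^sub>m n n) (1\<^sub>m n) (- 1\<^sub>m n) (0\<^sub>m n n)"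

definition Sp :: "nat \<Rightarrow> int Matrix.mat set" where
  "Sp n = {\<gamma> \<in> carrier_mat (2 * n) (2 * n).
             transpose_mat \<gamma> * symplectic_form n * \<gamma> = symplectic_form n}"

definition in_Gamma12 ::
    "nat \<Rightarrow> int Matrix.mat \<Rightarrow> int Matrix.mat \<Rightarrow> int Matrix.mat \<Rightarrow> int Matrix.mat \<Rightarrow> bool" where
  "in_Gamma12 n a b c d \<longleftrightarrow>
     a \<in> carrier_mat n n \<and> b \<in> carrier_mat n n \<and> c \<in> carrier_mat n n \<and> d \<in> carrier_mat n n \<and>
     four_block_mat a b c d \<in> Sp n \<and>
     (\<forall>i < n. even ((transpose_mat a * c) $$ (i, i)) \<and> even ((transpose_mat b * d) $$ (i, i)))"

definition denom :: "int Matrix.mat \<Rightarrow> int Matrix.mat \<Rightarrow> complex Matrix.mat \<Rightarrow> complex Matrix.mat" where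
  "denom c d \<tau> = cmat c * \<tau> + cmat d"

text \<open>Only used for \<open>denom c d \<tau>\<close>, which is invertible for symplectic matrices and
  \<open>\<tau>\<close> in the Siegel space.\<close>

definition mat_inv :: "complex Matrix.mat \<Rightarrow> complex Matrix.mat" where
  "mat_inv A = the (mat_inverse A)"

definition act_z ::
    "int Matrix.mat \<Rightarrow> int Matrix.mat \<Rightarrow> complex Matrix.vec \<Rightarrow> complex Matrix.mat \<Rightarrow> complex Matrix.vec" where
  "act_z c d z \<tau> = transpose_mat (mat_inv (denom c d \<tau>)) *\<^sub>v z"

definition act_tau ::
    "int Matrix.mat \<Rightarrow> int Matrix.mat \<Rightarrow> int Matrix.mat \<Rightarrow> int Matrix.mat \<Rightarrow> complex Matrix.mat \<Rightarrow> complex Matrix.mat" where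
  "act_tau a b c d \<tau> = (cmat a * \<tau> + cmat b) * mat_inv (denom c d \<tau>)"

definition exp_factor ::
    "int Matrix.mat \<Rightarrow> int Matrix.mat \<Rightarrow> complex Matrix.vec \<Rightarrow> complex Matrix.mat \<Rightarrow> complex" where
  "exp_factor c d z \<tau> = exp (pi * \<i> * quad (mat_inv (denom c d \<tau>) * cmat c) z)"

definition sqrt_branch ::
    "nat \<Rightarrow> int Matrix.mat \<Rightarrow> int Matrix.mat \<Rightarrow> (complex Matrix.mat \<Rightarrow> complex) \<Rightarrow> bool" where
  "sqrt_branch n c d s \<longleftrightarrow>
     continuous_on_siegel n s \<and>
     (\<forall>\<tau> \<in> siegel_space n. s \<tau> ^ 2 = Determinant.det (denom c d \<tau>))"

text \<open>\<open>\<zeta>\<close> is the root of unity $\zeta_\gamma$ of the theta transformation formula relative to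
  the branch \<open>s\<close> of $\det(c\tau+d)^{1/2}$. It is unique, since theta does not vanish identically.\<close>

definition theta_multiplier ::
    "nat \<Rightarrow> int Matrix.mat \<Rightarrow> int Matrix.mat \<Rightarrow> int Matrix.mat \<Rightarrow> int Matrix.mat
      \<Rightarrow> (complex Matrix.mat \<Rightarrow> complex) \<Rightarrow> complex \<Rightarrow> bool" where
  "theta_multiplier n a b c d s \<zeta> \<longleftrightarrow>
     \<zeta> ^ 8 = 1 \<and>
     (\<forall>z \<in> carrier_vec n. \<forall>\<tau> \<in> siegel_space n.
        riemann_theta n (act_z c d z \<tau>) (act_tau a b c d \<tau>) =
          \<zeta> * s \<tau> * exp_factor c d z \<tau> * riemann_theta n z \<tau>)"

end

theory Submission
  imports Defs
begin

text \<open>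
  Up to sign, \<open>\<eta>\<close> is the determinant of the Hessian \<open>H\<close> of theta bordered by its gradient \<open>g\<close>.
  Both transformation laws of theta have the form \<open>F'(w) = c exp(l(Bw + p)) F(Bw + p)\<close> with a
  quadratic polynomial \<open>l\<close>. Where \<open>F\<close> vanishes, differentiating twice gives, with \<open>E = c exp(l)\<close> and
  \<open>u\<close> the gradient of \<open>l\<close>, the gradient \<open>E B\<^sup>t g\<close> and the Hessian \<open>E B\<^sup>t (H + u g\<^sup>t + g u\<^sup>t) B\<close>.
  The terms in \<open>u\<close> are removed by row and column operations with the border, so the bordered
  determinant is multiplied by \<open>E\<close> to the power \<open>n + 1\<close> and by the square of \<open>det B\<close>. For the modular
  transformation \<open>B\<close> is the transpose of \<open>c\<tau> + d\<close>, which contributes the extra four powers of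
  its square root.
\<close>

no_notation fps_nth (infixl "$" 75)

subsection \<open>Bordered determinants\<close>

text \<open>The cofactors of a sum of matrices do not simplify, so the correction
  \<open>u g^t + g u^t\<close> of the Hessian is hard to follow inside \<open>eta\<close> itself;
  next to the border \<open>g\<close> it is a combination of a row and a column already present.
  Second derivatives of the exponent also enter the new Hessian, but only multiplied by theta, and
  no row operation would remove them: this is why the laws are claimed on the zero locus alone. The
  weight is read off from the size of the bordered matrix: \<open>n + 1\<close> factors of weight
  1/2 and a squared determinant of weight 2 add up to \<open>(n + 5) / 2\<close>. On the analytic
  side the obstacle is that vectors of variable size form no normed space. Differentiation is
  therefore carried out along complex lines, and all estimates rest on explicit bounds for the
  coefficients of the series, which come from the positivity of \<open>Im \<tau>\<close>. On the
  algebraic side \<open>mat_inv\<close> has its intended meaning only where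
  \<open>c\<tau> + d\<close> is invertible, so this has to be proved before the action can be
  inverted.\<close>

definition bordered :: "'a::comm_ring_1 Matrix.mat \<Rightarrow> 'a Matrix.mat \<Rightarrow> 'a Matrix.mat" where
  "bordered H G = four_block_mat H G (transpose_mat G) (0\<^sub>m 1 1)"

lemma bordered_carrier:
  assumes "H \<in> carrier_mat n n" "G \<in> carrier_mat n 1"
  shows "bordered H G \<in> carrier_mat (Suc n) (Suc n)"
  using four_block_carrier_mat[of H n n "0\<^sub>m 1 1" 1 1 G "transpose_mat G"] assms by (simp add: bordered_def)

lemma col_mat_carrier: "mat_of_cols n [g] \<in> carrier_mat n 1"
  by (rule carrier_matI) simp_all

lemma quad_eq_sum:
  assumes "A \<in> carrier_mat n n" "x \<in> carrier_vec n"
  shows "quad A x = (\<Sum>i<n. \<Sum>j<n. x $ i * A $$ (i, j) * x $ j)"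
  using assms by (auto simp: scalar_prod_def sum_distrib_left mult.assoc atLeast0LessThan intro!: sum.cong)

text \<open>Expanding along the border row leaves minors that are \<open>H\<close> without column
  \<open>j\<close>, followed by the column \<open>g\<close>. Expanding these along \<open>g\<close>
  produces the minors of \<open>H\<close>, hence a quadratic form in \<open>g\<close> with the
  cofactors as coefficients.\<close>

lemma det_bordered:
  assumes H: "H \<in> carrier_mat n n" and g: "g \<in> carrier_vec n"
  shows "Determinant.det (bordered H (mat_of_cols n [g])) = - quad (cofactor_mat H) g"
proof (cases n)
  \<comment> \<open>The general case expands along column \<open>n - 1\<close> of the minors, which
    does not exist here; the bordered matrix is the zero matrix of size 1.\<close>
  case 0
  have "quad (cofactor_mat H) g = 0"
    using quad_eq_sum[of "cofactor_mat H" n g] H g 0 by (simp add: scalar_prod_def)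
  moreover have "Determinant.det (bordered H (mat_of_cols n [g])) = 0"
  proof -
    let ?B = "bordered H (mat_of_cols n [g])"
    have B: "?B \<in> carrier_mat 1 1"
      using bordered_carrier[OF H col_mat_carrier, of g] 0 by simp
    have "?B $$ (0,0) = 0" using H 0 by (simp add: bordered_def)
    then show ?thesis
      using laplace_expansion_column[OF B, of 0] by simp
  qed
  ultimately show ?thesis by simp
next
  case (Suc k)
  let ?G = "mat_of_cols n [g]"
  let ?B = "bordered H ?G"
  have B: "?B \<in> carrier_mat (Suc n) (Suc n)" by (rule bordered_carrier[OF H col_mat_carrier])
  have Bn: "?B $$ (n, j) = (if j < n then g $ j else 0)" if "j < Suc n" for j
    using that H g by (auto simp: bordered_def mat_of_cols_index)
  have cof: "cofactor ?B n j = - (\<Sum>i<n. g $ i * cofactor H i j)" if j: "j < n" for j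
  proof -
    let ?M = "mat_delete ?B n j"
    have M: "?M \<in> carrier_mat n n" using mat_delete_carrier[OF B, of n j] by simp
    have Mi: "?M $$ (i, k) = g $ i" if "i < n" for i
      using that B H g j Suc by (auto simp: mat_delete_def bordered_def mat_of_cols_index)
    have del: "mat_delete ?M i k = mat_delete H i j" if "i < n" for i
      by (rule eq_matI) (use that B H g j Suc in \<open>auto simp: mat_delete_def bordered_def\<close>)
    have "Determinant.det ?M = (\<Sum>i<n. g $ i * ((-1) ^ (i + k) * Determinant.det (mat_delete H i j)))"
    proof -
      have "Determinant.det ?M = (\<Sum>i<n. ?M $$ (i, k) * cofactor ?M i k)"
        using laplace_expansion_column[OF M, of k] Suc by blast
      also have "\<dots> = (\<Sum>i<n. g $ i * ((-1) ^ (i + k) * Determinant.det (mat_delete H i j)))"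
        by (rule sum.cong[OF refl]) (simp only: Mi del cofactor_def lessThan_iff)
      finally show ?thesis .
    qed
    then have "cofactor ?B n j =
        (\<Sum>i<n. (-1) ^ (n + j) * (g $ i * ((-1) ^ (i + k) * Determinant.det (mat_delete H i j))))"
      by (simp add: cofactor_def sum_distrib_left)
    also have "\<dots> = (\<Sum>i<n. - (g $ i * cofactor H i j))"
    proof (rule sum.cong[OF refl])
      fix i
      \<comment> \<open>As \<open>n = k + 1\<close>, the exponents \<open>n + j + i + k\<close> and
        \<open>i + j\<close> differ by an odd number. This is the origin of the minus sign in the
        lemma.\<close>
      have "(-1) ^ (n + j) * (-1) ^ (i + k) = - ((-1) ^ (i + j) :: 'a)"
        by (cases "even k"; cases "even i"; cases "even j") (simp_all add: Suc power_add)
      then show "(-1) ^ (n + j) * (g $ i * ((-1) ^ (i + k) * Determinant.det (mat_delete H i j)))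
          = - (g $ i * cofactor H i j)"
        unfolding cofactor_def by (metis (no_types, lifting) mult.assoc mult.left_commute mult_minus_left mult_minus_right)
    qed
    finally show ?thesis by (simp add: sum_negf)
  qed
  have "Determinant.det ?B = (\<Sum>j<n. g $ j * cofactor ?B n j)"
    using laplace_expansion_row[OF B, of n] by (simp add: Bn)
  also have "\<dots> = - (\<Sum>j<n. \<Sum>i<n. g $ i * cofactor H i j * g $ j)"
    by (simp add: cof sum_distrib_left sum_negf mult_ac)
  also have "(\<Sum>j<n. \<Sum>i<n. g $ i * cofactor H i j * g $ j) = quad (cofactor_mat H) g"
    using H g by (subst sum.swap, subst quad_eq_sum[of _ n]) (auto simp: cofactor_mat_def)
  finally show ?thesis .
qed

text \<open>Multiplication by \<open>L\<close> on the left adds multiples of the border row to the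
  rows of \<open>H\<close>, and its transpose does the same to the columns. The zero corner matters:
  a corner entry \<open>x\<close> would contribute a further term \<open>U x U^t\<close>. The border
  is a matrix with one column so that block multiplication applies.\<close>

lemma bordered_transform:
  assumes H: "H \<in> carrier_mat n n" and G: "G \<in> carrier_mat n 1" and U: "U \<in> carrier_mat n 1"
    and D: "D \<in> carrier_mat n n"
  defines "L \<equiv> four_block_mat D (D * U) (0\<^sub>m 1 n) (1\<^sub>m 1)"
  shows "bordered (D * (H + U * transpose_mat G + G * transpose_mat U) * transpose_mat D) (D * G)
           = L * bordered H G * transpose_mat L"
proof -
  have [simp]: "transpose_mat G \<in> carrier_mat 1 n" "transpose_mat U \<in> carrier_mat 1 n"
     "transpose_mat D \<in> carrier_mat n n" "D * U \<in> carrier_mat n 1" "D * G \<in> carrier_mat n 1"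
    using G U D by auto
  note [simp] = H G U D and [simp del] = One_nat_def
  have zero: "D * U * 0\<^sub>m 1 1 = 0\<^sub>m n 1" "0\<^sub>m 1 n * H = 0\<^sub>m 1 n" "0\<^sub>m 1 n * G = 0\<^sub>m 1 1"
    by (simp_all add: right_mult_zero_mat[of _ n 1] left_mult_zero_mat[OF H] left_mult_zero_mat[OF G])
  have W [simp]: "D * H + D * U * transpose_mat G \<in> carrier_mat n n"
    by (intro add_carrier_mat mult_carrier_mat[of "D * U" n 1]) simp_all
  have GD: "transpose_mat G * transpose_mat D \<in> carrier_mat 1 n"
    by (rule mult_carrier_mat[of _ 1 n]) simp_all
  have zero': "(D * H + D * U * transpose_mat G) * 0\<^sub>m n 1 = 0\<^sub>m n 1" "transpose_mat G * 0\<^sub>m n 1 = 0\<^sub>m 1 1"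
      "0\<^sub>m 1 1 * transpose_mat (D * U) = 0\<^sub>m 1 n" "D * G * 1\<^sub>m 1 = D * G"
    by (simp_all add: right_mult_zero_mat[OF W] right_mult_zero_mat[of _ 1 n] left_mult_zero_mat[of _ 1 n] right_mult_one_mat[of _ n])
  have one: "1\<^sub>m 1 * transpose_mat G = transpose_mat G"
    by (simp add: left_mult_one_mat[of _ 1 n])
  have LB: "L * bordered H G = four_block_mat (D * H + D * U * transpose_mat G) (D * G) (transpose_mat G) (0\<^sub>m 1 1)"
    unfolding L_def bordered_def by (subst mult_four_block_mat[where ?nr1.0 = n and ?n1.0 = n and ?n2.0 = 1 and ?nr2.0 = 1 and ?nc1.0 = n and ?nc2.0 = 1])
      (auto simp: zero one)
  have LT: "transpose_mat L = four_block_mat (transpose_mat D) (0\<^sub>m n 1) (transpose_mat (D * U)) (1\<^sub>m 1)"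
    unfolding L_def by (subst transpose_four_block_mat[of _ n n _ 1 _ 1]) auto
  have "L * bordered H G * transpose_mat L =
      four_block_mat ((D * H + D * U * transpose_mat G) * transpose_mat D + D * G * transpose_mat (D * U))
        (D * G) (transpose_mat G * transpose_mat D) (0\<^sub>m 1 1)"
    unfolding LB LT by (subst mult_four_block_mat[where ?nr1.0 = n and ?n1.0 = n and ?n2.0 = 1 and ?nr2.0 = 1 and ?nc1.0 = n and ?nc2.0 = 1])
      (simp_all add: zero' right_add_zero_mat[of _ n 1] right_add_zero_mat[OF GD])
  also have "transpose_mat G * transpose_mat D = transpose_mat (D * G)"
    by (simp add: transpose_mult[OF D G])
  also have "(D * H + D * U * transpose_mat G) * transpose_mat D + D * G * transpose_mat (D * U)
     = D * (H + U * transpose_mat G + G * transpose_mat U) * transpose_mat D"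
  proof -
    have UG: "U * transpose_mat G \<in> carrier_mat n n" and GU: "G * transpose_mat U \<in> carrier_mat n n"
      and DGU: "D * G * transpose_mat U \<in> carrier_mat n n"
      by (rule mult_carrier_mat[of _ n 1]; simp)+
    have "D * (H + U * transpose_mat G + G * transpose_mat U)
        = D * H + D * (U * transpose_mat G) + D * (G * transpose_mat U)"
      using mult_add_distrib_mat[OF D _ GU] mult_add_distrib_mat[OF D H UG] H UG by simp
    also have "D * (U * transpose_mat G) = D * U * transpose_mat G"
      by (rule assoc_mult_mat[of _ n n _ 1 _ n, symmetric]) simp_all
    also have "D * (G * transpose_mat U) = D * G * transpose_mat U"
      by (rule assoc_mult_mat[of _ n n _ 1 _ n, symmetric]) simp_all
    finally have "D * (H + U * transpose_mat G + G * transpose_mat U) * transpose_mat D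
        = (D * H + D * U * transpose_mat G + D * G * transpose_mat U) * transpose_mat D"
      by (rule arg_cong)
    also have "(D * H + D * U * transpose_mat G + D * G * transpose_mat U) * transpose_mat D
        = (D * H + D * U * transpose_mat G) * transpose_mat D + D * G * transpose_mat U * transpose_mat D"
      by (rule add_mult_distrib_mat[OF W DGU, of _ n]) simp
    also have "D * G * transpose_mat U * transpose_mat D = D * G * transpose_mat (D * U)"
      unfolding transpose_mult[OF D U] by (rule assoc_mult_mat[of _ n 1 _ n _ n]) simp_all
    finally show ?thesis by (rule sym)
  qed
  finally show ?thesis unfolding bordered_def by simp
qed

text \<open>The exponent \<open>n + 1\<close> is the size of the bordered matrix, all of which is
  scaled by \<open>c\<close>. The block triangular \<open>L\<close> has the determinant of
  \<open>D\<close> and occurs on both sides, which gives the square.\<close>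

lemma quad_cofactor_transform:
  fixes H :: "'a::idom Matrix.mat"
  assumes H: "H \<in> carrier_mat n n" and g: "g \<in> carrier_vec n" and u: "u \<in> carrier_vec n"
    and D: "D \<in> carrier_mat n n"
    and H': "H' = c \<cdot>\<^sub>m (D * (H + Matrix.mat n n (\<lambda>(i, j). u $ i * g $ j + g $ i * u $ j)) * transpose_mat D)"
    and g': "g' = c \<cdot>\<^sub>v (D *\<^sub>v g)"
  shows "quad (cofactor_mat H') g' = c ^ (n + 1) * Determinant.det D ^ 2 * quad (cofactor_mat H) g"
proof -
  let ?G = "mat_of_cols n [g]" and ?U = "mat_of_cols n [u]"
  define L where "L = four_block_mat D (D * ?U) (0\<^sub>m 1 n) (1\<^sub>m 1)"
  have L: "L \<in> carrier_mat (Suc n) (Suc n)"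
    using four_block_carrier_mat[of D n n "1\<^sub>m 1" 1 1] D by (simp add: L_def)
  have detL: "Determinant.det L = Determinant.det D"
    unfolding L_def by (subst det_four_block_mat_lower_left_zero[of _ n _ 1]) (use D in auto)
  have B: "bordered H ?G \<in> carrier_mat (Suc n) (Suc n)" by (rule bordered_carrier[OF H col_mat_carrier])
  define K where "K = H + ?U * transpose_mat ?G + ?G * transpose_mat ?U"
  have K: "K \<in> carrier_mat n n" using H by (auto simp: K_def)
  have K_eq: "H + Matrix.mat n n (\<lambda>(i, j). u $ i * g $ j + g $ i * u $ j) = K"
    unfolding K_def by (rule eq_matI)
      (use H u g in \<open>auto simp: scalar_prod_def mat_of_cols_index\<close>)
  have [simp]: "g' \<in> carrier_vec n" "H' \<in> carrier_mat n n"
    using D g by (auto simp: g' H')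
  have "bordered H' (mat_of_cols n [g']) = c \<cdot>\<^sub>m bordered (D * K * transpose_mat D) (D * ?G)"
  proof -
    have "mat_of_cols n [g'] = c \<cdot>\<^sub>m (D * ?G)"
      by (rule eq_matI) (use D g in \<open>auto simp: g' scalar_prod_def mat_of_cols_index\<close>)
    moreover have "transpose_mat (c \<cdot>\<^sub>m (D * ?G)) = c \<cdot>\<^sub>m transpose_mat (D * ?G)"
      by (rule eq_matI) auto
    moreover have "D * K * transpose_mat D \<in> carrier_mat n n" "D * ?G \<in> carrier_mat n 1"
      "transpose_mat (D * ?G) \<in> carrier_mat 1 n"
      using D K by (auto intro!: mult_carrier_mat[of _ n n] carrier_matI)
    \<comment> \<open>The corner is unaffected by scaling, so \<open>c\<close> is a common factor of
      all four blocks.\<close>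
    moreover have "0\<^sub>m 1 1 = c \<cdot>\<^sub>m 0\<^sub>m 1 1" by (rule eq_matI) auto
    ultimately show ?thesis
      unfolding bordered_def H' K_eq by (simp only: smult_four_block_mat zero_carrier_mat)
  qed
  also have "bordered (D * K * transpose_mat D) (D * ?G) = L * bordered H ?G * transpose_mat L"
    unfolding L_def K_def by (rule bordered_transform) (use H D in auto)
  finally have "Determinant.det (bordered H' (mat_of_cols n [g'])) =
      c ^ (n + 1) * (Determinant.det D ^ 2 * Determinant.det (bordered H ?G))"
    using L B by (simp add: det_mult[of _ "Suc n"] det_transpose[OF L] detL power2_eq_square)
  then show ?thesis
    using det_bordered[OF H g] det_bordered[of H' n g'] by simp
qed

subsection \<open>Gradients along complex lines\<close>

lemma has_sum_finite_sum:
  fixes f :: "'i \<Rightarrow> 'a \<Rightarrow> 'b::{topological_comm_monoid_add}"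
  assumes "finite I" "\<And>i. i \<in> I \<Longrightarrow> (f i has_sum s i) A"
  shows "((\<lambda>x. \<Sum>i\<in>I. f i x) has_sum (\<Sum>i\<in>I. s i)) A"
  using assms by (induction I rule: finite_induct) (auto intro!: has_sum_add)

lemma has_sum_diff:
  fixes f g :: "'a \<Rightarrow> 'b::real_normed_vector"
  assumes "(f has_sum a) A" "(g has_sum b) A"
  shows "((\<lambda>x. f x - g x) has_sum (a - b)) A"
  using has_sum_add[OF assms(1) has_sum_uminus[THEN iffD2], of g "- b"] assms(2) by simp

lemma summable_on_norm_comparison:
  fixes f :: "'a \<Rightarrow> 'b::banach"
  assumes "g summable_on A" "\<And>x. x \<in> A \<Longrightarrow> norm (f x) \<le> g x"
  shows "f summable_on A"
  by (rule abs_summable_summable, rule summable_on_comparison_test[OF assms(1)]) (simp_all add: assms(2))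

text \<open>The second order Taylor estimate of \<open>exp\<close>, summed over \<open>m\<close>,
  bounds the remainder of the sum by a constant times \<open>norm t ^ 2\<close>. Summability for
  every \<open>R\<close> leaves room to absorb the powers of \<open>a m\<close> that appear.\<close>

lemma has_field_derivative_infsum_exp:
  fixes q a :: "'i \<Rightarrow> complex"
  assumes summable: "\<And>R. (\<lambda>m. norm (q m) * exp (R * norm (a m))) summable_on A"
  shows "((\<lambda>t. \<Sum>\<^sub>\<infinity>m\<in>A. q m * exp (t * a m)) has_field_derivative (\<Sum>\<^sub>\<infinity>m\<in>A. a m * q m)) (at 0)"
proof -
  define f where "f t = (\<Sum>\<^sub>\<infinity>m\<in>A. q m * exp (t * a m))" for t
  define D where "D = (\<Sum>\<^sub>\<infinity>m\<in>A. a m * q m)"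
  have f: "((\<lambda>m. q m * exp (t * a m)) has_sum f t) A" for t
    unfolding f_def
  proof (rule has_sum_infsum, rule summable_on_norm_comparison[OF summable[of "norm t"]])
    fix m
    have "Re (t * a m) \<le> norm t * norm (a m)"
      by (metis complex_Re_le_cmod norm_mult)
    then show "norm (q m * exp (t * a m)) \<le> norm (q m) * exp (norm t * norm (a m))"
      by (simp add: norm_mult mult_left_mono)
  qed
  have D: "((\<lambda>m. a m * q m) has_sum D) A"
    unfolding D_def
  proof (rule has_sum_infsum, rule summable_on_norm_comparison[OF summable[of 1]])
    fix m
    have "norm (a m) \<le> exp (norm (a m))"
      using exp_ge_add_one_self[of "norm (a m)"] by linarith
    then show "norm (a m * q m) \<le> norm (q m) * exp (1 * norm (a m))"
      by (metis mult.commute mult_1 mult_left_mono norm_ge_zero norm_mult)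
  qed
  \<comment> \<open>For \<open>norm t \<le> 1\<close> and \<open>x = norm (a m)\<close> the Taylor
    remainder is at most \<open>norm t ^ 2 * exp x * x ^ 2\<close>, and
    \<open>x ^ 2 \<le> 2 * exp x\<close>; this explains both factors 2.\<close>
  define K where "K = (\<Sum>\<^sub>\<infinity>m\<in>A. 2 * (norm (q m) * exp (2 * norm (a m))))"
  have K: "((\<lambda>m. 2 * (norm (q m) * exp (2 * norm (a m)))) has_sum K) A"
    unfolding K_def by (intro has_sum_infsum summable_on_cmult_right summable)
  have bound: "norm (f t - f 0 - t * D) \<le> norm t ^ 2 * K" if t: "norm t \<le> 1" for t
  proof (rule norm_infsum_le)
    show "((\<lambda>m. q m * exp (t * a m) - q m * exp (0 * a m) - t * (a m * q m)) has_sum (f t - f 0 - t * D)) A"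
      by (intro has_sum_diff has_sum_cmult_right f D)
    show "((\<lambda>m. norm t ^ 2 * (2 * (norm (q m) * exp (2 * norm (a m))))) has_sum (norm t ^ 2 * K)) A"
      by (intro has_sum_cmult_right K)
    fix m
    define x where "x = norm (a m)"
    have x: "x \<ge> 0" by (simp add: x_def)
    have "norm (exp (t * a m) - 1 - t * a m) \<le> exp (norm (t * a m)) * norm (t * a m) ^ 2"
      using Taylor_exp_field[of "t * a m" 1] by (simp add: algebra_simps power2_eq_square)
    also have "\<dots> = norm t ^ 2 * (exp (norm t * x) * x ^ 2)"
      by (simp add: norm_mult power_mult_distrib x_def)
    also have "\<dots> \<le> norm t ^ 2 * (exp x * (2 * exp x))"
    proof (intro mult_left_mono mult_mono)
      show "exp (norm t * x) \<le> exp x" using t x by (simp add: mult_left_le_one_le)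
      show "x ^ 2 \<le> 2 * exp x" using exp_lower_Taylor_quadratic[OF x] x by (simp add: field_simps)
    qed auto
    also have "exp x * (2 * exp x) = 2 * exp (2 * x)"
      by (simp add: exp_add[symmetric])
    finally have "norm (q m) * norm (exp (t * a m) - 1 - t * a m) \<le> norm (q m) * (norm t ^ 2 * (2 * exp (2 * x)))"
      by (rule mult_left_mono) simp
    moreover have "norm (q m * exp (t * a m) - q m * exp (0 * a m) - t * (a m * q m))
        = norm (q m) * norm (exp (t * a m) - 1 - t * a m)"
      unfolding norm_mult[symmetric] by (simp add: algebra_simps)
    ultimately show "norm (q m * exp (t * a m) - q m * exp (0 * a m) - t * (a m * q m))
        \<le> norm t ^ 2 * (2 * (norm (q m) * exp (2 * norm (a m))))"
      by (simp add: x_def mult_ac)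
  qed
  have "((\<lambda>h. (f (0 + h) - f 0) / h - D) \<longlongrightarrow> 0) (at 0)"
  proof (rule Lim_null_comparison)
    show "((\<lambda>h. norm h * K) \<longlongrightarrow> 0) (at (0::complex))"
      by (auto intro!: tendsto_eq_intros)
    have "norm ((f (0 + h) - f 0) / h - D) \<le> norm h * K" if "h \<noteq> 0" "norm h < 1" for h
    proof -
      have "(f (0 + h) - f 0) / h - D = (f h - f 0 - h * D) / h"
        using that by (simp add: field_simps)
      then have "norm ((f (0 + h) - f 0) / h - D) = norm (f h - f 0 - h * D) / norm h"
        by (simp add: norm_divide)
      also have "\<dots> \<le> norm h ^ 2 * K / norm h"
        using bound[of h] that by (intro divide_right_mono) auto
      finally show ?thesis using that by (simp add: power2_eq_square)
    qed
    then show "\<forall>\<^sub>F h in at 0. norm ((f (0 + h) - f 0) / h - D) \<le> norm h * K"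
      unfolding eventually_at by (intro exI[of _ 1]) (auto simp: dist_norm)
  qed
  then have "((\<lambda>h. (f (0 + h) - f 0) / h) \<longlongrightarrow> D) (at 0)"
    by (simp add: LIM_zero_iff)
  then show ?thesis unfolding DERIV_def f_def D_def .
qed

text \<open>A Gateaux form of complex differentiability: only functions of one complex variable are
  differentiated. Directions are arbitrary, not just coordinate directions, since linear
  substitutions do not preserve the latter.\<close>

definition has_grad :: "nat \<Rightarrow> (complex Matrix.vec \<Rightarrow> complex) \<Rightarrow> (nat \<Rightarrow> complex Matrix.vec \<Rightarrow> complex) \<Rightarrow> bool" where
  "has_grad n F G \<longleftrightarrow> (\<forall>z \<in> carrier_vec n. \<forall>v \<in> carrier_vec n.
     ((\<lambda>t. F (z + t \<cdot>\<^sub>v v)) has_field_derivative (\<Sum>i<n. v $ i * G i z)) (at 0))"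

lemma has_gradD:
  "has_grad n F G \<Longrightarrow> z \<in> carrier_vec n \<Longrightarrow> v \<in> carrier_vec n \<Longrightarrow>
     ((\<lambda>t. F (z + t \<cdot>\<^sub>v v)) has_field_derivative (\<Sum>i<n. v $ i * G i z)) (at 0)"
  by (simp add: has_grad_def)

lemma has_grad_cong:
  assumes "has_grad n F G" "\<And>z. z \<in> carrier_vec n \<Longrightarrow> F' z = F z"
    "\<And>z i. z \<in> carrier_vec n \<Longrightarrow> i < n \<Longrightarrow> G' i z = G i z"
  shows "has_grad n F' G'"
  using assms by (simp add: has_grad_def)

lemma cpartial_eq:
  assumes "has_grad n F G" "z \<in> carrier_vec n" "i < n"
  shows "cpartial n i F z = G i z"
proof -
  have "(\<Sum>j<n. unit_vec n i $ j * G j z) = (\<Sum>j<n. if j = i then G i z else 0)"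
    using assms by (intro sum.cong) auto
  then show ?thesis
    using DERIV_imp_deriv[OF has_gradD[OF assms(1,2), of "unit_vec n i"]] assms
    by (simp add: cpartial_def)
qed

lemma cpartial_cong:
  assumes "\<And>z. z \<in> carrier_vec n \<Longrightarrow> F z = F' z" "z \<in> carrier_vec n" "i < n"
  shows "cpartial n i F z = cpartial n i F' z"
  using assms by (simp add: cpartial_def)

text \<open>Derivatives at parameter 0 suffice because the base point is arbitrary: the line through
  \<open>z\<close> is reparametrised from its point with parameter \<open>w0\<close>.\<close>

lemma has_grad_holomorphic:
  assumes F: "has_grad n F G" and z: "z \<in> carrier_vec n" and v: "v \<in> carrier_vec n"
  shows "(\<lambda>w. F (z + w \<cdot>\<^sub>v v)) holomorphic_on UNIV"
  unfolding holomorphic_on_def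
proof
  fix w0 :: complex
  have eq: "z + w \<cdot>\<^sub>v v = (z + w0 \<cdot>\<^sub>v v) + (w - w0) \<cdot>\<^sub>v v" for w
    using z v by (intro eq_vecI) (auto simp: algebra_simps)
  have "((\<lambda>t. F ((z + w0 \<cdot>\<^sub>v v) + t \<cdot>\<^sub>v v)) has_field_derivative (\<Sum>i<n. v $ i * G i (z + w0 \<cdot>\<^sub>v v))) (at (w0 - w0))"
    using has_gradD[OF F, of "z + w0 \<cdot>\<^sub>v v" v] z v by simp
  moreover have "((\<lambda>w. w - w0) has_field_derivative 1) (at w0)"
    by (auto intro!: derivative_eq_intros)
  ultimately have "((\<lambda>w. F ((z + w0 \<cdot>\<^sub>v v) + (w - w0) \<cdot>\<^sub>v v)) has_field_derivative
      (\<Sum>i<n. v $ i * G i (z + w0 \<cdot>\<^sub>v v)) * 1) (at w0)"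
    by (rule DERIV_chain2)
  then have "((\<lambda>w. F (z + w \<cdot>\<^sub>v v)) has_field_derivative (\<Sum>i<n. v $ i * G i (z + w0 \<cdot>\<^sub>v v))) (at w0)"
    by (simp add: eq[symmetric])
  then show "(\<lambda>w. F (z + w \<cdot>\<^sub>v v)) field_differentiable (at w0 within UNIV)"
    using field_differentiable_def by blast
qed

lemma has_grad_mult:
  assumes "has_grad n F G" "has_grad n F' G'"
  shows "has_grad n (\<lambda>z. F z * F' z) (\<lambda>i z. G i z * F' z + F z * G' i z)"
  unfolding has_grad_def
proof safe
  fix z v :: "complex Matrix.vec" assume zv: "z \<in> carrier_vec n" "v \<in> carrier_vec n"
  have [simp]: "z + 0 \<cdot>\<^sub>v v = z" using zv by auto
  show "((\<lambda>t. F (z + t \<cdot>\<^sub>v v) * F' (z + t \<cdot>\<^sub>v v)) has_field_derivative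
      (\<Sum>i<n. v $ i * (G i z * F' z + F z * G' i z))) (at 0)"
    using DERIV_mult[OF has_gradD[OF assms(1) zv] has_gradD[OF assms(2) zv]]
    by (simp add: algebra_simps sum.distrib sum_distrib_left)
qed

lemma has_grad_add:
  assumes "has_grad n F G" "has_grad n F' G'"
  shows "has_grad n (\<lambda>z. F z + F' z) (\<lambda>i z. G i z + G' i z)"
  unfolding has_grad_def
proof safe
  fix z v :: "complex Matrix.vec" assume zv: "z \<in> carrier_vec n" "v \<in> carrier_vec n"
  show "((\<lambda>t. F (z + t \<cdot>\<^sub>v v) + F' (z + t \<cdot>\<^sub>v v)) has_field_derivative
      (\<Sum>i<n. v $ i * (G i z + G' i z))) (at 0)"
    using DERIV_add[OF has_gradD[OF assms(1) zv] has_gradD[OF assms(2) zv]]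
    by (simp add: algebra_simps sum.distrib)
qed

lemma has_grad_const: "has_grad n (\<lambda>z. c) (\<lambda>i z. 0)"
  by (simp add: has_grad_def)

lemma has_grad_sum:
  assumes "finite I" "\<And>k. k \<in> I \<Longrightarrow> has_grad n (F k) (G k)"
  shows "has_grad n (\<lambda>z. \<Sum>k\<in>I. F k z) (\<lambda>i z. \<Sum>k\<in>I. G k i z)"
  using assms by (induction I rule: finite_induct) (auto intro: has_grad_const has_grad_add)

lemma has_grad_exp:
  assumes "has_grad n F G"
  shows "has_grad n (\<lambda>z. exp (F z)) (\<lambda>i z. exp (F z) * G i z)"
  unfolding has_grad_def
proof safe
  fix z v :: "complex Matrix.vec" assume zv: "z \<in> carrier_vec n" "v \<in> carrier_vec n"
  have [simp]: "z + 0 \<cdot>\<^sub>v v = z" using zv by auto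
  show "((\<lambda>t. exp (F (z + t \<cdot>\<^sub>v v))) has_field_derivative
      (\<Sum>i<n. v $ i * (exp (F z) * G i z))) (at 0)"
    using DERIV_fun_exp[OF has_gradD[OF assms(1) zv]]
    by (simp add: mult_ac sum_distrib_left)
qed

text \<open>The line in direction \<open>v\<close> goes to the line in direction
  \<open>B *\<^sub>v v\<close>. Collecting the coefficient of each coordinate of \<open>v\<close>
  transposes \<open>B\<close>.\<close>

lemma has_grad_affine:
  assumes F: "has_grad n F G" and B: "B \<in> carrier_mat n n" and p: "p \<in> carrier_vec n"
  shows "has_grad n (\<lambda>w. F (B *\<^sub>v w + p)) (\<lambda>i w. \<Sum>k<n. B $$ (k, i) * G k (B *\<^sub>v w + p))"
  unfolding has_grad_def
proof safe
  fix z v :: "complex Matrix.vec" assume zv: "z \<in> carrier_vec n" "v \<in> carrier_vec n"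
  have eq: "B *\<^sub>v (z + t \<cdot>\<^sub>v v) + p = (B *\<^sub>v z + p) + t \<cdot>\<^sub>v (B *\<^sub>v v)" for t
  proof -
    have "B *\<^sub>v (z + t \<cdot>\<^sub>v v) = B *\<^sub>v z + t \<cdot>\<^sub>v (B *\<^sub>v v)"
      using B zv by (simp add: mult_add_distrib_mat_vec mult_mat_vec[of _ n n])
    then show ?thesis using B zv p by (intro eq_vecI) auto
  qed
  have "(\<Sum>k<n. (B *\<^sub>v v) $ k * G k (B *\<^sub>v z + p)) = (\<Sum>k<n. \<Sum>i<n. v $ i * (B $$ (k, i) * G k (B *\<^sub>v z + p)))"
    using B zv by (auto simp: scalar_prod_def sum_distrib_right sum_distrib_left atLeast0LessThan mult_ac intro!: sum.cong)
  also have "\<dots> = (\<Sum>i<n. v $ i * (\<Sum>k<n. B $$ (k, i) * G k (B *\<^sub>v z + p)))"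
    by (subst sum.swap) (simp add: sum_distrib_left)
  finally show "((\<lambda>t. F (B *\<^sub>v (z + t \<cdot>\<^sub>v v) + p)) has_field_derivative
      (\<Sum>i<n. v $ i * (\<Sum>k<n. B $$ (k, i) * G k (B *\<^sub>v z + p)))) (at 0)"
    using has_gradD[OF F, of "B *\<^sub>v z + p" "B *\<^sub>v v"] B zv p by (simp add: eq)
qed

subsection \<open>Rapidly convergent Fourier series\<close>

text \<open>The coefficients have to beat every exponential of the l1 norm, not merely every
  polynomial: at non-real points the characters themselves grow exponentially in \<open>m\<close>.
  The condition yields convergence for every complex argument and is stable under
  differentiation.\<close>

definition rapidly_decreasing :: "nat \<Rightarrow> (int Matrix.vec \<Rightarrow> complex) \<Rightarrow> bool" where
  "rapidly_decreasing n p \<longleftrightarrow>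
     (\<forall>R. (\<lambda>m. norm (p m) * exp (R * (\<Sum>i<n. \<bar>real_of_int (m $ i)\<bar>))) summable_on carrier_vec n)"

definition fourier :: "nat \<Rightarrow> (int Matrix.vec \<Rightarrow> complex) \<Rightarrow> complex Matrix.vec \<Rightarrow> complex" where
  "fourier n p z = (\<Sum>\<^sub>\<infinity>m \<in> carrier_vec n. p m * exp (2 * pi * \<i> * (cvec m \<bullet> z)))"

definition fourier_deriv :: "nat \<Rightarrow> (int Matrix.vec \<Rightarrow> complex) \<Rightarrow> int Matrix.vec \<Rightarrow> complex" where
  "fourier_deriv i p m = 2 * pi * \<i> * of_int (m $ i) * p m"

text \<open>The new factor, the absolute value of \<open>m $ i\<close>, is at most
  \<open>exp\<close> of the l1 norm of \<open>m\<close>, so passing from \<open>R\<close> to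
  \<open>R + 1\<close> absorbs it.\<close>

lemma rapidly_decreasing_fourier_deriv:
  assumes p: "rapidly_decreasing n p" and i: "i < n"
  shows "rapidly_decreasing n (fourier_deriv i p)"
  unfolding rapidly_decreasing_def
proof
  fix R
  let ?s = "\<lambda>m :: int Matrix.vec. \<Sum>i<n. \<bar>real_of_int (m $ i)\<bar>"
  have "(\<lambda>m. 2 * pi * (norm (p m) * exp ((R + 1) * ?s m))) summable_on carrier_vec n"
    using p unfolding rapidly_decreasing_def by (intro summable_on_cmult_right) blast
  then show "(\<lambda>m. norm (fourier_deriv i p m) * exp (R * ?s m)) summable_on carrier_vec n"
  proof (rule summable_on_norm_comparison)
    fix m :: "int Matrix.vec"
    have "\<bar>real_of_int (m $ i)\<bar> \<le> ?s m"
      using i by (intro member_le_sum) auto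
    also have "\<dots> \<le> exp (?s m)" using exp_ge_add_one_self[of "?s m"] by linarith
    finally have "\<bar>real_of_int (m $ i)\<bar> * (norm (p m) * exp (R * ?s m)) \<le> exp (?s m) * (norm (p m) * exp (R * ?s m))"
      by (rule mult_right_mono) simp
    then show "norm (norm (fourier_deriv i p m) * exp (R * ?s m)) \<le> 2 * pi * (norm (p m) * exp ((R + 1) * ?s m))"
      by (simp add: fourier_deriv_def norm_mult exp_add algebra_simps)
  qed
qed

lemma norm_exp_char_le:
  fixes z :: "complex Matrix.vec"
  assumes "m \<in> carrier_vec n" "z \<in> carrier_vec n" "\<And>i. i < n \<Longrightarrow> norm (z $ i) \<le> R"
  shows "norm (2 * pi * \<i> * (cvec m \<bullet> z)) \<le> 2 * pi * R * (\<Sum>i<n. \<bar>real_of_int (m $ i)\<bar>)"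
    and "norm (exp (2 * pi * \<i> * (cvec m \<bullet> z))) \<le> exp (2 * pi * R * (\<Sum>i<n. \<bar>real_of_int (m $ i)\<bar>))"
proof -
  have "norm (cvec m \<bullet> z) \<le> (\<Sum>i<n. norm (of_int (m $ i) * z $ i))"
    using assms by (auto simp: scalar_prod_def atLeast0LessThan intro: norm_sum)
  also have "\<dots> \<le> (\<Sum>i<n. R * \<bar>real_of_int (m $ i)\<bar>)"
    using assms(3) by (intro sum_mono) (simp add: norm_mult mult.commute mult_right_mono)
  finally have *: "norm (cvec m \<bullet> z) \<le> R * (\<Sum>i<n. \<bar>real_of_int (m $ i)\<bar>)"
    by (simp add: sum_distrib_left)
  then show 1: "norm (2 * pi * \<i> * (cvec m \<bullet> z)) \<le> 2 * pi * R * (\<Sum>i<n. \<bar>real_of_int (m $ i)\<bar>)"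
    by (simp add: norm_mult)
  show "norm (exp (2 * pi * \<i> * (cvec m \<bullet> z))) \<le> exp (2 * pi * R * (\<Sum>i<n. \<bar>real_of_int (m $ i)\<bar>))"
    by (rule order_trans[OF norm_exp]) (simp only: exp_le_cancel_iff 1)
qed

lemma vec_bound:
  fixes z :: "complex Matrix.vec"
  obtains R where "\<And>i. i < n \<Longrightarrow> norm (z $ i) \<le> R" "R \<ge> 0"
  by (rule that[of "\<Sum>i<n. norm (z $ i)"]) (auto intro: member_le_sum sum_nonneg)

lemma fourier_has_sum:
  assumes p: "rapidly_decreasing n p" and z: "z \<in> carrier_vec n"
  shows "((\<lambda>m. p m * exp (2 * pi * \<i> * (cvec m \<bullet> z))) has_sum fourier n p z) (carrier_vec n)"
proof -
  obtain R where R: "\<And>i. i < n \<Longrightarrow> norm (z $ i) \<le> R" using vec_bound by blast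
  have "(\<lambda>m. p m * exp (2 * pi * \<i> * (cvec m \<bullet> z))) summable_on carrier_vec n"
  proof (rule summable_on_norm_comparison)
    show "(\<lambda>m. norm (p m) * exp (2 * pi * R * (\<Sum>i<n. \<bar>real_of_int (m $ i)\<bar>))) summable_on carrier_vec n"
      using p unfolding rapidly_decreasing_def by blast
    show "norm (p m * exp (2 * pi * \<i> * (cvec m \<bullet> z)))
        \<le> norm (p m) * exp (2 * pi * R * (\<Sum>i<n. \<bar>real_of_int (m $ i)\<bar>))" if "m \<in> carrier_vec n" for m
      unfolding norm_mult by (intro mult_left_mono norm_exp_char_le that z R) auto
  qed
  then show ?thesis unfolding fourier_def by (rule has_sum_infsum)
qed

lemma has_grad_fourier:
  assumes p: "rapidly_decreasing n p"
  shows "has_grad n (fourier n p) (\<lambda>i. fourier n (fourier_deriv i p))"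
  unfolding has_grad_def
proof safe
  fix z v :: "complex Matrix.vec" assume z: "z \<in> carrier_vec n" and v: "v \<in> carrier_vec n"
  let ?s = "\<lambda>m :: int Matrix.vec. \<Sum>i<n. \<bar>real_of_int (m $ i)\<bar>"
  obtain R where R: "\<And>i. i < n \<Longrightarrow> norm (z $ i) \<le> R" using vec_bound by blast
  obtain V where V: "\<And>i. i < n \<Longrightarrow> norm (v $ i) \<le> V" "V \<ge> 0" using vec_bound by blast
  \<comment> \<open>Along the line through \<open>z\<close> the term with index \<open>m\<close> is
    \<open>q m * exp (t * a m)\<close>: the dependence on \<open>z\<close> is frozen into the
    coefficient, and the result on exponential series applies.\<close>
  define q where "q m = p m * exp (2 * pi * \<i> * (cvec m \<bullet> z))" for m
  define a where "a m = 2 * pi * \<i> * (cvec m \<bullet> v)" for m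
  have "((\<lambda>t. \<Sum>\<^sub>\<infinity>m\<in>carrier_vec n. q m * exp (t * a m)) has_field_derivative
      (\<Sum>\<^sub>\<infinity>m\<in>carrier_vec n. a m * q m)) (at 0)"
  proof (rule has_field_derivative_infsum_exp)
    fix T :: real
    \<comment> \<open>One part of the exponent bounds the character at \<open>z\<close>, the other
      the growth in the direction \<open>v\<close>; the absolute value is there because
      \<open>T\<close> may be negative.\<close>
    have "(\<lambda>m. norm (p m) * exp ((2 * pi * R + \<bar>T\<bar> * (2 * pi * V)) * ?s m)) summable_on carrier_vec n"
      using p unfolding rapidly_decreasing_def by blast
    then show "(\<lambda>m. norm (q m) * exp (T * norm (a m))) summable_on carrier_vec n"
    proof (rule summable_on_norm_comparison)
      fix m :: "int Matrix.vec" assume m: "m \<in> carrier_vec n"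
      have "T * norm (a m) \<le> \<bar>T\<bar> * norm (a m)" by (intro mult_right_mono) auto
      also have "\<dots> \<le> \<bar>T\<bar> * (2 * pi * V * ?s m)"
        unfolding a_def by (intro mult_left_mono norm_exp_char_le m v V) auto
      finally have "exp (T * norm (a m)) \<le> exp (\<bar>T\<bar> * (2 * pi * V * ?s m))" by simp
      moreover have "norm (q m) \<le> norm (p m) * exp (2 * pi * R * ?s m)"
        unfolding q_def norm_mult by (intro mult_left_mono norm_exp_char_le m z R) auto
      ultimately have "norm (q m) * exp (T * norm (a m))
          \<le> (norm (p m) * exp (2 * pi * R * ?s m)) * exp (\<bar>T\<bar> * (2 * pi * V * ?s m))"
        by (intro mult_mono) auto
      also have "\<dots> = norm (p m) * exp ((2 * pi * R + \<bar>T\<bar> * (2 * pi * V)) * ?s m)"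
        by (simp add: distrib_right exp_add mult.assoc)
      finally show "norm (norm (q m) * exp (T * norm (a m)))
          \<le> norm (p m) * exp ((2 * pi * R + \<bar>T\<bar> * (2 * pi * V)) * ?s m)" by simp
    qed
  qed
  moreover have "(\<Sum>\<^sub>\<infinity>m\<in>carrier_vec n. q m * exp (t * a m)) = fourier n p (z + t \<cdot>\<^sub>v v)" for t
    unfolding fourier_def
  proof (rule infsum_cong)
    fix m :: "int Matrix.vec" assume m: "m \<in> carrier_vec n"
    have "cvec m \<bullet> (z + t \<cdot>\<^sub>v v) = cvec m \<bullet> z + t * (cvec m \<bullet> v)"
      using m z v by (simp add: scalar_prod_add_distrib[of _ n])
    then show "q m * exp (t * a m) = p m * exp (2 * pi * \<i> * (cvec m \<bullet> (z + t \<cdot>\<^sub>v v)))"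
      by (simp add: q_def a_def exp_add[symmetric] algebra_simps)
  qed
  moreover have "(\<Sum>\<^sub>\<infinity>m\<in>carrier_vec n. a m * q m) = (\<Sum>i<n. v $ i * fourier n (fourier_deriv i p) z)"
  proof (rule infsumI, rule has_sum_cong[THEN iffD1])
    show "((\<lambda>m. \<Sum>i<n. v $ i * (fourier_deriv i p m * exp (2 * pi * \<i> * (cvec m \<bullet> z)))) has_sum
        (\<Sum>i<n. v $ i * fourier n (fourier_deriv i p) z)) (carrier_vec n)"
      by (intro has_sum_finite_sum has_sum_cmult_right fourier_has_sum rapidly_decreasing_fourier_deriv p z) auto
    fix m :: "int Matrix.vec" assume m: "m \<in> carrier_vec n"
    show "(\<Sum>i<n. v $ i * (fourier_deriv i p m * exp (2 * pi * \<i> * (cvec m \<bullet> z)))) = a m * q m"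
      using m v by (simp add: a_def q_def fourier_deriv_def scalar_prod_def atLeast0LessThan
          sum_distrib_left sum_distrib_right mult_ac)
  qed
  ultimately show "((\<lambda>t. fourier n p (z + t \<cdot>\<^sub>v v)) has_field_derivative
      (\<Sum>i<n. v $ i * fourier n (fourier_deriv i p) z)) (at 0)" by simp
qed

text \<open>The polydiscs \<open>X R\<close> restrict finitely many coordinates, so they are open in
  the product topology, and they cover the space. On each of them the coefficient bound with
  constant \<open>2 * pi * R\<close> is a majorant for the Weierstrass test.\<close>

lemma continuous_on_fourier:
  assumes p: "rapidly_decreasing n p"
  shows "continuous_on UNIV (\<lambda>x :: nat \<Rightarrow> complex. fourier n p (Matrix.vec n x))"
proof -
  define X where "X R = (\<Inter>i<n. {x :: nat \<Rightarrow> complex. norm (x i) < R})" for R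
  have open_X: "open (X R)" for R
    unfolding X_def
    by (intro open_INT ballI open_Collect_less continuous_on_norm continuous_on_const) auto
  have "continuous_on (X R) (\<lambda>x. fourier n p (Matrix.vec n x))" for R
  proof (rule uniform_limit_theorem)
    show "uniform_limit (X R) (\<lambda>M x. \<Sum>m\<in>M. p m * exp (2 * pi * \<i> * (cvec m \<bullet> Matrix.vec n x)))
       (\<lambda>x. fourier n p (Matrix.vec n x)) (finite_subsets_at_top (carrier_vec n))"
      unfolding fourier_def
    proof (rule Weierstrass_m_test_general)
      show "(\<lambda>m. norm (p m) * exp (2 * pi * R * (\<Sum>i<n. \<bar>real_of_int (m $ i)\<bar>))) summable_on carrier_vec n"
        using p unfolding rapidly_decreasing_def by blast
      show "norm (p m * exp (2 * pi * \<i> * (cvec m \<bullet> Matrix.vec n x)))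
          \<le> norm (p m) * exp (2 * pi * R * (\<Sum>i<n. \<bar>real_of_int (m $ i)\<bar>))"
        if "m \<in> carrier_vec n" "x \<in> X R" for m x
        unfolding norm_mult by (intro mult_left_mono norm_exp_char_le that) (use that in \<open>auto simp: X_def less_imp_le\<close>)
    qed
    have "continuous_on (X R) (\<lambda>x. p m * exp (2 * pi * \<i> * (cvec m \<bullet> Matrix.vec n x)))" for m
      unfolding scalar_prod_def
      by (intro continuous_intros) (auto intro!: continuous_intros continuous_on_subset[OF continuous_on_product_coordinates])
    then show "\<forall>\<^sub>F M in finite_subsets_at_top (carrier_vec n).
        continuous_on (X R) (\<lambda>x. \<Sum>m\<in>M. p m * exp (2 * pi * \<i> * (cvec m \<bullet> Matrix.vec n x)))"
      by (intro always_eventually allI continuous_on_sum)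
  qed auto
  then have "continuous_on (\<Union>R. X R) (\<lambda>x. fourier n p (Matrix.vec n x))"
    by (intro continuous_on_open_UN open_X)
  moreover have "(\<Union>R. X R) = UNIV"
  proof -
    \<comment> \<open>The summand 1 makes the inequality strict, as the open polydisc
      demands.\<close>
    have "x \<in> X (1 + (\<Sum>i<n. norm (x i)))" for x
    proof -
      have "norm (x i) \<le> (\<Sum>i<n. norm (x i))" if "i < n" for i
        using that by (intro member_le_sum) auto
      then show ?thesis by (fastforce simp: X_def)
    qed
    then show ?thesis by blast
  qed
  ultimately show ?thesis by simp
qed

subsection \<open>The theta series\<close>

lemma det_nonzero_inverse:
  fixes D :: "'a::field Matrix.mat"
  assumes "D \<in> carrier_mat n n" "Determinant.det D \<noteq> 0"
  obtains B where "mat_inverse D = Some B" "B \<in> carrier_mat n n" "D * B = 1\<^sub>m n" "B * D = 1\<^sub>m n"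
proof (cases "mat_inverse D")
  case None
  then show ?thesis
    using mat_inverse(1)[OF assms(1) None, of "()"] det_non_zero_imp_unit[OF assms, of "()"] by blast
next
  case (Some B)
  then show ?thesis using mat_inverse(2)[OF assms(1) Some] that by blast
qed

lemma scalar_prod_mat_symmetric:
  fixes A :: "'a::comm_ring_1 Matrix.mat"
  assumes "A \<in> carrier_mat n n" "transpose_mat A = A" "x \<in> carrier_vec n" "y \<in> carrier_vec n"
  shows "x \<bullet> (A *\<^sub>v y) = y \<bullet> (A *\<^sub>v x)"
  using transpose_vec_mult_scalar[OF assms(1,4,3)] comm_scalar_prod[of "A *\<^sub>v x" n y] assms by simp

lemma quad_add:
  fixes A :: "'a::comm_ring_1 Matrix.mat"
  assumes "A \<in> carrier_mat n n" "transpose_mat A = A" "x \<in> carrier_vec n" "y \<in> carrier_vec n"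
  shows "quad A (x + y) = quad A x + 2 * (y \<bullet> (A *\<^sub>v x)) + quad A y"
proof -
  have "A *\<^sub>v (x + y) = A *\<^sub>v x + A *\<^sub>v y" using assms by (intro mult_add_distrib_mat_vec)
  then show ?thesis
    using assms scalar_prod_mat_symmetric[OF assms]
    by (simp add: scalar_prod_add_distrib[of _ n] add_scalar_prod_distrib[of _ n])
qed

lemma quad_nonneg:
  fixes Y :: "real Matrix.mat"
  assumes "Y \<in> carrier_mat n n" and pos: "\<And>x. x \<in> carrier_vec n \<Longrightarrow> x \<noteq> 0\<^sub>v n \<Longrightarrow> quad Y x > 0"
    and x: "x \<in> carrier_vec n"
  shows "quad Y x \<ge> 0"
proof (cases "x = 0\<^sub>v n")
  case True
  have "Y *\<^sub>v 0\<^sub>v n \<in> carrier_vec n" using assms by simp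
  then show ?thesis using True by simp
next
  case False
  then show ?thesis using pos[OF x] by simp
qed

text \<open>Cauchy--Schwarz for the form \<open>Y\<close>, applied to \<open>x\<close> and \<open>Y\<^sup>-\<^sup>1 e\<^sub>i\<close>.\<close>

lemma pos_def_coord_le:
  fixes Y :: "real Matrix.mat"
  assumes Y: "Y \<in> carrier_mat n n" "transpose_mat Y = Y"
    and pos: "\<And>x. x \<in> carrier_vec n \<Longrightarrow> x \<noteq> 0\<^sub>v n \<Longrightarrow> quad Y x > 0"
    and w: "w \<in> carrier_vec n" "Y *\<^sub>v w = unit_vec n i" and i: "i < n" and x: "x \<in> carrier_vec n"
  shows "(x $ i)\<^sup>2 \<le> quad Y w * quad Y x"
proof -
  have "w \<noteq> 0\<^sub>v n"
  proof
    assume "w = 0\<^sub>v n"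
    moreover have "Y *\<^sub>v 0\<^sub>v n = 0\<^sub>v n" using Y by (intro eq_vecI) auto
    ultimately have "unit_vec n i = (0\<^sub>v n :: real Matrix.vec)" using w by simp
    then have "unit_vec n i $ i = (0\<^sub>v n :: real Matrix.vec) $ i" by simp
    then show False using i by simp
  qed
  then have q: "quad Y w > 0" using pos w by blast
  \<comment> \<open>The minimiser of \<open>quad Y (x + t w)\<close> in \<open>t\<close>: since
    \<open>Y w\<close> is the unit vector, the cross term is \<open>t\<close> times the coordinate
    \<open>x $ i\<close>.\<close>
  define t where "t = - (x $ i) / quad Y w"
  have tw: "t \<cdot>\<^sub>v w \<in> carrier_vec n" using w by simp
  have xw: "x \<bullet> (Y *\<^sub>v (t \<cdot>\<^sub>v w)) = t * x $ i"
    using x i w Y by (simp add: mult_mat_vec[OF Y(1) w(1)])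
  have ww: "quad Y (t \<cdot>\<^sub>v w) = t\<^sup>2 * quad Y w"
    using w Y by (simp add: mult_mat_vec[OF Y(1) w(1)] power2_eq_square del: w(2))
  have "0 \<le> quad Y (x + t \<cdot>\<^sub>v w)" using x tw by (intro quad_nonneg[OF Y(1) pos]) auto
  also have "\<dots> = quad Y x + 2 * (t * x $ i) + t\<^sup>2 * quad Y w"
    using quad_add[OF Y x tw] xw scalar_prod_mat_symmetric[OF Y x tw] ww by simp
  also have "\<dots> = quad Y x - (x $ i)\<^sup>2 / quad Y w"
    using q by (simp add: t_def field_simps power2_eq_square)
  finally show ?thesis using q by (simp add: field_simps)
qed

text \<open>An explicit constant replaces compactness of the sphere. The value
  \<open>quad Y (w i)\<close> is the diagonal entry of the inverse of \<open>Y\<close> at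
  \<open>i\<close>, so summing the coordinate bounds gives the trace of the inverse; the extra 1 in
  \<open>K\<close> keeps the denominator positive for \<open>n = 0\<close> as well.\<close>

lemma pos_def_lower_bound:
  fixes Y :: "real Matrix.mat"
  assumes Y: "Y \<in> carrier_mat n n" "transpose_mat Y = Y"
    and pos: "\<And>x. x \<in> carrier_vec n \<Longrightarrow> x \<noteq> 0\<^sub>v n \<Longrightarrow> quad Y x > 0"
  obtains \<mu> where "\<mu> > 0" "\<And>x. x \<in> carrier_vec n \<Longrightarrow> \<mu> * (\<Sum>i<n. (x $ i)\<^sup>2) \<le> quad Y x"
proof -
  have "Determinant.det Y \<noteq> 0"
  proof
    assume "Determinant.det Y = 0"
    then obtain v where v: "v \<in> carrier_vec n" "v \<noteq> 0\<^sub>v n" "Y *\<^sub>v v = 0\<^sub>v n"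
      using det_0_iff_vec_prod_zero_field[OF Y(1)] by blast
    then show False using pos[OF v(1,2)] by simp
  qed
  then obtain B where B: "B \<in> carrier_mat n n" "Y * B = 1\<^sub>m n"
    using det_nonzero_inverse[OF Y(1)] by metis
  define w where "w i = B *\<^sub>v unit_vec n i" for i
  have w: "w i \<in> carrier_vec n" "Y *\<^sub>v w i = unit_vec n i" for i
    using B Y by (auto simp: w_def assoc_mult_mat_vec[of Y n n B n, symmetric] simp del: assoc_mult_mat_vec)
  have nonneg: "quad Y (w i) \<ge> 0" for i by (rule quad_nonneg[OF Y(1) pos w(1)])
  define K where "K = 1 + (\<Sum>i<n. quad Y (w i))"
  have "K > 0" unfolding K_def by (intro add_pos_nonneg sum_nonneg nonneg) auto
  have "1 / K * (\<Sum>i<n. (x $ i)\<^sup>2) \<le> quad Y x" if x: "x \<in> carrier_vec n" for x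
  proof -
    have "quad Y x \<ge> 0" by (rule quad_nonneg[OF Y(1) pos x])
    have "(\<Sum>i<n. (x $ i)\<^sup>2) \<le> (\<Sum>i<n. quad Y (w i) * quad Y x)"
      by (rule sum_mono) (simp add: pos_def_coord_le[OF Y pos w _ x])
    also have "\<dots> = (\<Sum>i<n. quad Y (w i)) * quad Y x" by (simp add: sum_distrib_right)
    also have "\<dots> \<le> K * quad Y x"
      using \<open>quad Y x \<ge> 0\<close> unfolding K_def by (intro mult_right_mono) auto
    finally show ?thesis using \<open>K > 0\<close> by (simp add: field_simps)
  qed
  then show ?thesis using that[of "1 / K"] \<open>K > 0\<close> by simp
qed

text \<open>A finite set of vectors lies in a finite box, and over a box the sum of products is the
  product of the one-dimensional sums. All terms being nonnegative, bounded partial sums are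
  enough.\<close>

lemma summable_on_prod_carrier_vec:
  fixes f :: "'a \<Rightarrow> real"
  assumes f: "f summable_on UNIV" and nonneg: "\<And>x. f x \<ge> 0"
  shows "(\<lambda>m. \<Prod>i<n. f (m $ i)) summable_on carrier_vec n"
proof (rule nonneg_bdd_above_summable_on)
  show "bdd_above (sum (\<lambda>m. \<Prod>i<n. f (m $ i)) ` {S. S \<subseteq> carrier_vec n \<and> finite S})"
  proof (rule bdd_aboveI2)
    fix S :: "'a Matrix.vec set" assume "S \<in> {S. S \<subseteq> carrier_vec n \<and> finite S}"
    then have S: "S \<subseteq> carrier_vec n" "finite S" by auto
    \<comment> \<open>\<open>T\<close> collects every coordinate that occurs in \<open>S\<close>.
      The map \<open>h\<close> turns vectors into extensional functions, the elements of the product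
      set over which sums and products can be interchanged.\<close>
    define T where "T = (\<Union>m\<in>S. \<Union>i\<in>{..<n}. {m $ i})"
    define h where "h m = restrict (\<lambda>i. m $ i) {..<n}" for m :: "'a Matrix.vec"
    have T: "finite T" using S by (auto simp: T_def)
    have inj: "inj_on h S"
    proof (rule inj_onI)
      fix x y assume xy: "x \<in> S" "y \<in> S" "h x = h y"
      have "x $ i = y $ i" if "i < n" for i
        using fun_cong[OF xy(3), of i] that by (simp add: h_def)
      moreover have "x \<in> carrier_vec n" "y \<in> carrier_vec n" using xy S by auto
      ultimately show "x = y" by (intro eq_vecI) auto
    qed
    have "(\<Sum>m\<in>S. \<Prod>i<n. f (m $ i)) = (\<Sum>m\<in>S. (\<lambda>g. \<Prod>i<n. f (g i)) (h m))"
      by (intro sum.cong prod.cong) (auto simp: h_def)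
    also have "\<dots> = (\<Sum>g\<in>h ` S. \<Prod>i<n. f (g i))"
      using inj by (simp add: sum.reindex)
    also have "\<dots> \<le> (\<Sum>g\<in>PiE {..<n} (\<lambda>_. T). \<Prod>i<n. f (g i))"
    proof (rule sum_mono2)
      show "finite (PiE {..<n} (\<lambda>_. T))" using T by (intro finite_PiE) auto
      show "h ` S \<subseteq> PiE {..<n} (\<lambda>_. T)"
      proof (rule image_subsetI)
        fix m assume "m \<in> S"
        then have "m $ i \<in> T" if "i < n" for i using that unfolding T_def by blast
        then show "h m \<in> PiE {..<n} (\<lambda>_. T)" unfolding h_def restrict_PiE_iff by blast
      qed
    qed (auto intro: prod_nonneg nonneg)
    also have "\<dots> = (\<Prod>i<n. \<Sum>y\<in>T. f y)"
      using T by (intro prod_sum_PiE[symmetric]) auto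
    also have "\<dots> \<le> (\<Prod>i<n. infsum f UNIV)"
      using T f nonneg by (intro prod_mono conjI sum_nonneg finite_sum_le_infsum) auto
    finally show "(\<Sum>m\<in>S. \<Prod>i<n. f (m $ i)) \<le> (\<Prod>i<n. infsum f UNIV)" .
  qed
qed (auto intro: prod_nonneg nonneg)

text \<open>Completing the square compares the terms with a geometric series: \<open>C\<close> is
  the maximum of \<open>(R + 1) * x - a * x\<^sup>2\<close>, so the exponent is at most
  \<open>C - x\<close>.\<close>

lemma summable_on_gaussian_int:
  assumes a: "a > 0"
  shows "(\<lambda>k::int. exp (R * \<bar>real_of_int k\<bar> - a * (real_of_int k)\<^sup>2)) summable_on UNIV"
proof -
  define C where "C = (R + 1)\<^sup>2 / (4 * a)"
  have bound: "exp (R * \<bar>real_of_int k\<bar> - a * (real_of_int k)\<^sup>2) \<le> exp C * exp (- \<bar>real_of_int k\<bar>)" for k :: int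
  proof -
    define x where "x = \<bar>real_of_int k\<bar>"
    have "C - ((R + 1) * x - a * x\<^sup>2) = a * (x - (R + 1) / (2 * a))\<^sup>2"
      using a by (simp add: C_def power2_eq_square field_simps)
    also have "\<dots> \<ge> 0" using a by simp
    finally have "R * x - a * x\<^sup>2 \<le> C + - x" by (simp add: algebra_simps)
    then have "exp (R * x - a * x\<^sup>2) \<le> exp (C + - x)" by simp
    then show ?thesis unfolding exp_add by (simp add: x_def)
  qed
  have "summable (\<lambda>n. exp (-1 :: real) ^ n)" by (rule summable_geometric) simp
  then have nat: "(\<lambda>n. exp (- real n)) summable_on UNIV"
    by (subst summable_on_UNIV_nonneg_real_iff) (simp_all add: exp_of_nat_mult[symmetric])
  have pos: "(\<lambda>k::int. exp (- \<bar>real_of_int k\<bar>)) summable_on range int"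
    using nat by (subst summable_on_reindex) (simp_all add: o_def)
  have neg: "(\<lambda>k::int. exp (- \<bar>real_of_int k\<bar>)) summable_on range (\<lambda>n. - int n)"
    using nat by (subst summable_on_reindex) (simp_all add: o_def inj_on_def)
  \<comment> \<open>The two halves overlap in 0, which is harmless for summability.\<close>
  have "(UNIV :: int set) = range int \<union> range (\<lambda>n. - int n)"
    by (auto simp: image_iff) (metis int_cases2)
  then have "(\<lambda>k::int. exp C * exp (- \<bar>real_of_int k\<bar>)) summable_on UNIV"
    using summable_on_union[OF pos neg] by (intro summable_on_cmult_right) simp
  then show ?thesis
    by (rule summable_on_comparison_test) (use bound in auto)
qed

section \<open>Theta as a Fourier series, and its quasi-periodicity\<close>

definition theta_coeff :: "complex Matrix.mat \<Rightarrow> int Matrix.vec \<Rightarrow> complex" where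
  "theta_coeff \<tau> m = exp (pi * \<i> * quad \<tau> (cvec m))"

lemma riemann_theta_eq_fourier:
  "riemann_theta n z \<tau> = fourier n (theta_coeff \<tau>) z"
  by (simp add: riemann_theta_def fourier_def theta_coeff_def exp_add)

lemma Im_transpose:
  assumes "\<tau> \<in> siegel_space n"
  shows "transpose_mat (map_mat Im \<tau>) = map_mat Im \<tau>"
proof -
  have t: "transpose_mat \<tau> = \<tau>" "\<tau> \<in> carrier_mat n n" using assms by (auto simp: siegel_space_def)
  have "transpose_mat (map_mat Im \<tau>) = map_mat Im (transpose_mat \<tau>)"
    using t(2) by (intro eq_matI) auto
  then show ?thesis using t by simp
qed

text \<open>The absolute value of a coefficient involves only \<open>Im \<tau>\<close>. Once this
  form is bounded below by a multiple of the sum of squares, the majorant is a product over the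
  coordinates, and each factor is a one-dimensional Gaussian.\<close>

lemma rapidly_decreasing_theta_coeff:
  assumes \<tau>: "\<tau> \<in> siegel_space n"
  shows "rapidly_decreasing n (theta_coeff \<tau>)"
proof -
  have t: "\<tau> \<in> carrier_mat n n" using \<tau> by (simp add: siegel_space_def)
  let ?Y = "map_mat Im \<tau>"
  obtain \<mu> where \<mu>: "\<mu> > 0" "\<And>x. x \<in> carrier_vec n \<Longrightarrow> \<mu> * (\<Sum>i<n. (x $ i)\<^sup>2) \<le> quad ?Y x"
    by (rule pos_def_lower_bound[of ?Y n]) (use \<tau> Im_transpose[OF \<tau>] in \<open>auto simp: siegel_space_def\<close>)
  show ?thesis
    unfolding rapidly_decreasing_def
  proof
    fix R :: real
    have "(\<lambda>m::int Matrix.vec. \<Prod>i<n. exp (R * \<bar>real_of_int (m $ i)\<bar> - pi * \<mu> * (real_of_int (m $ i))\<^sup>2))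
        summable_on carrier_vec n"
      using \<mu>(1) by (intro summable_on_prod_carrier_vec summable_on_gaussian_int) auto
    then show "(\<lambda>m. norm (theta_coeff \<tau> m) * exp (R * (\<Sum>i<n. \<bar>real_of_int (m $ i)\<bar>))) summable_on carrier_vec n"
    proof (rule summable_on_comparison_test)
      fix m :: "int Matrix.vec" assume m: "m \<in> carrier_vec n"
      \<comment> \<open>The vector \<open>m\<close> is real, so taking imaginary parts affects only
        the entries of \<open>\<tau>\<close>.\<close>
      have "Im (quad \<tau> (cvec m)) = quad ?Y (map_vec of_int m)"
        using m t by (subst (1 2) quad_eq_sum[of _ n]) (auto simp: algebra_simps)
      then have "norm (theta_coeff \<tau> m) = exp (- pi * quad ?Y (map_vec of_int m))"
        by (simp add: theta_coeff_def)
      also have "\<dots> \<le> exp (- pi * (\<mu> * (\<Sum>i<n. (real_of_int (m $ i))\<^sup>2)))"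
        using \<mu>(2)[of "map_vec of_int m"] m by simp
      finally have "norm (theta_coeff \<tau> m) * exp (R * (\<Sum>i<n. \<bar>real_of_int (m $ i)\<bar>))
          \<le> exp (- pi * (\<mu> * (\<Sum>i<n. (real_of_int (m $ i))\<^sup>2))) * exp (R * (\<Sum>i<n. \<bar>real_of_int (m $ i)\<bar>))"
        by (rule mult_right_mono) simp
      also have "\<dots> = exp (\<Sum>i<n. R * \<bar>real_of_int (m $ i)\<bar> - pi * \<mu> * (real_of_int (m $ i))\<^sup>2)"
        by (simp add: exp_add[symmetric] sum_subtractf sum_distrib_left sum_negf mult.assoc)
      also have "\<dots> = (\<Prod>i<n. exp (R * \<bar>real_of_int (m $ i)\<bar> - pi * \<mu> * (real_of_int (m $ i))\<^sup>2))"
        by (rule exp_sum) simp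
      finally show "norm (theta_coeff \<tau> m) * exp (R * (\<Sum>i<n. \<bar>real_of_int (m $ i)\<bar>))
          \<le> (\<Prod>i<n. exp (R * \<bar>real_of_int (m $ i)\<bar> - pi * \<mu> * (real_of_int (m $ i))\<^sup>2))" .
    qed simp
  qed
qed

text \<open>Translation by \<open>\<tau> u\<close> completes the square: the exponent at
  \<open>m\<close> becomes the one at \<open>m + u\<close> plus terms free of \<open>m\<close>, and
  \<open>m + u\<close> again runs through the lattice. Translation by \<open>v\<close> contributes
  an integer multiple of \<open>2 pi i\<close>.\<close>

lemma riemann_theta_quasi_periodic:
  assumes \<tau>: "\<tau> \<in> siegel_space n" and u: "u \<in> carrier_vec n" and v: "v \<in> carrier_vec n" and z: "z \<in> carrier_vec n"
  shows "riemann_theta n (z + \<tau> *\<^sub>v cvec u + cvec v) \<tau> =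
    exp (- (pi * \<i> * quad \<tau> (cvec u)) - 2 * pi * \<i> * (cvec u \<bullet> z)) * riemann_theta n z \<tau>"
proof -
  have t: "\<tau> \<in> carrier_mat n n" "transpose_mat \<tau> = \<tau>" using \<tau> by (auto simp: siegel_space_def)
  let ?E = "exp (- (pi * \<i> * quad \<tau> (cvec u)) - 2 * pi * \<i> * (cvec u \<bullet> z))"
  let ?f = "\<lambda>m. exp (pi * \<i> * quad \<tau> (cvec m) + 2 * pi * \<i> * (cvec m \<bullet> z))"
  have "riemann_theta n (z + \<tau> *\<^sub>v cvec u + cvec v) \<tau> = (\<Sum>\<^sub>\<infinity>m \<in> carrier_vec n. ?E * ?f (m + u))"
    unfolding riemann_theta_def
  proof (rule infsum_cong)
    fix m :: "int Matrix.vec" assume m: "m \<in> carrier_vec n"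
    have add: "cvec (m + u) = cvec m + cvec u" using m u by (intro eq_vecI) auto
    have q: "quad \<tau> (cvec (m + u)) = quad \<tau> (cvec m) + 2 * (cvec m \<bullet> (\<tau> *\<^sub>v cvec u)) + quad \<tau> (cvec u)"
      using quad_add[OF t, of "cvec m" "cvec u"] scalar_prod_mat_symmetric[OF t, of "cvec m" "cvec u"] m u
      by (simp add: add)
    have l: "cvec m \<bullet> (z + \<tau> *\<^sub>v cvec u + cvec v) = cvec m \<bullet> z + cvec m \<bullet> (\<tau> *\<^sub>v cvec u) + cvec m \<bullet> cvec v"
      using m u v z t by (simp add: scalar_prod_add_distrib[of _ n])
    have r: "cvec (m + u) \<bullet> z = cvec m \<bullet> z + cvec u \<bullet> z"
      using m u z by (simp add: add add_scalar_prod_distrib[of _ n])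
    have "cvec m \<bullet> cvec v = of_int (m \<bullet> v)"
      using m v by (simp add: scalar_prod_def)
    then have one: "exp (2 * pi * \<i> * (cvec m \<bullet> cvec v)) = 1"
      using exp_integer_2pi[of "of_int (m \<bullet> v)"] by (simp add: mult_ac)
    have "exp (pi * \<i> * quad \<tau> (cvec m) + 2 * pi * \<i> * (cvec m \<bullet> (z + \<tau> *\<^sub>v cvec u + cvec v)))
        = ?E * ?f (m + u) * exp (2 * pi * \<i> * (cvec m \<bullet> cvec v))"
      unfolding q l r exp_add[symmetric] by (rule arg_cong[of _ _ exp]) (simp add: algebra_simps)
    then show "exp (pi * \<i> * quad \<tau> (cvec m) + 2 * pi * \<i> * (cvec m \<bullet> (z + \<tau> *\<^sub>v cvec u + cvec v))) = ?E * ?f (m + u)"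
      by (simp only: one mult_1_right)
  qed
  also have "\<dots> = ?E * (\<Sum>\<^sub>\<infinity>m \<in> carrier_vec n. ?f (m + u))"
    by (rule infsum_cmult_right')
  also have "(\<Sum>\<^sub>\<infinity>m \<in> carrier_vec n. ?f (m + u)) = (\<Sum>\<^sub>\<infinity>m \<in> carrier_vec n. ?f m)"
  proof (rule infsum_reindex_bij_betw)
    show "bij_betw (\<lambda>m. m + u) (carrier_vec n) (carrier_vec n)"
      by (rule bij_betw_byWitness[where f' = "\<lambda>m. m - u"]) (use u in \<open>auto intro!: eq_vecI\<close>)
  qed
  finally show ?thesis by (simp add: riemann_theta_def)
qed

subsection \<open>Invertibility of the automorphy factor\<close>

lemma four_block_mat_mult_append:
  assumes "A \<in> carrier_mat r1 c1" "B \<in> carrier_mat r1 c2" "C \<in> carrier_mat r2 c1" "D \<in> carrier_mat r2 c2"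
    and "x \<in> carrier_vec c1" "y \<in> carrier_vec c2"
  shows "four_block_mat A B C D *\<^sub>v (x @\<^sub>v y) = (A *\<^sub>v x + B *\<^sub>v y) @\<^sub>v (C *\<^sub>v x + D *\<^sub>v y)"
proof (rule eq_vecI)
  fix i assume "i < dim_vec ((A *\<^sub>v x + B *\<^sub>v y) @\<^sub>v (C *\<^sub>v x + D *\<^sub>v y))"
  then have i: "i < r1 + r2" using assms by simp
  have d: "dim_row (four_block_mat A B C D) = r1 + r2" using assms by simp
  show "(four_block_mat A B C D *\<^sub>v (x @\<^sub>v y)) $ i = ((A *\<^sub>v x + B *\<^sub>v y) @\<^sub>v (C *\<^sub>v x + D *\<^sub>v y)) $ i"
  proof (cases "i < r1")
    case True
    then have "(four_block_mat A B C D *\<^sub>v (x @\<^sub>v y)) $ i = (row A i @\<^sub>v row B i) \<bullet> (x @\<^sub>v y)"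
      using i d row_four_block_mat(1)[OF assms(1-4) True] by simp
    also have "\<dots> = row A i \<bullet> x + row B i \<bullet> y"
      using assms True by (intro scalar_prod_append[of _ c1 _ c2]) auto
    finally show ?thesis using True assms by simp
  next
    case False
    then have "(four_block_mat A B C D *\<^sub>v (x @\<^sub>v y)) $ i = (row C (i - r1) @\<^sub>v row D (i - r1)) \<bullet> (x @\<^sub>v y)"
      using i d row_four_block_mat(2)[OF assms(1-4) False i] by simp
    also have "\<dots> = row C (i - r1) \<bullet> x + row D (i - r1) \<bullet> y"
      using assms False i by (intro scalar_prod_append[of _ c1 _ c2]) auto
    finally show ?thesis using False assms i by simp
  qed
qed (use assms in auto)

text \<open>By symmetry of \<open>\<tau>\<close> the left side is the sesquilinear form of
  \<open>\<tau> - cnj \<tau>\<close>, that is \<open>2 i\<close> times the Hermitian form of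
  \<open>Im \<tau>\<close>. For a real symmetric matrix its mixed terms in \<open>Re v\<close> and
  \<open>Im v\<close> cancel.\<close>

lemma complex_quad_Im:
  assumes \<tau>: "\<tau> \<in> carrier_mat n n" "transpose_mat \<tau> = \<tau>" and v: "v \<in> carrier_vec n"
  shows "(\<tau> *\<^sub>v v) \<bullet> map_vec cnj v - v \<bullet> map_vec cnj (\<tau> *\<^sub>v v)
    = 2 * \<i> * (quad (map_mat Im \<tau>) (map_vec Re v) + quad (map_mat Im \<tau>) (map_vec Im v))"
proof -
  have sym: "\<tau> $$ (i, j) = \<tau> $$ (j, i)" if "i < n" "j < n" for i j
    using \<tau> that by (metis carrier_matD index_transpose_mat(1))
  let ?S = "\<lambda>f :: nat \<Rightarrow> nat \<Rightarrow> complex. \<Sum>i<n. \<Sum>j<n. f i j"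
  have 1: "(\<tau> *\<^sub>v v) \<bullet> map_vec cnj v = ?S (\<lambda>i j. \<tau> $$ (i, j) * v $ j * cnj (v $ i))"
    using \<tau> v by (auto simp: scalar_prod_def sum_distrib_right atLeast0LessThan intro!: sum.cong)
  have 2: "v \<bullet> map_vec cnj (\<tau> *\<^sub>v v) = ?S (\<lambda>i j. v $ i * cnj (\<tau> $$ (i, j)) * cnj (v $ j))"
    using \<tau> v by (auto simp: scalar_prod_def sum_distrib_left atLeast0LessThan mult.assoc intro!: sum.cong)
  also have "\<dots> = ?S (\<lambda>i j. v $ j * cnj (\<tau> $$ (j, i)) * cnj (v $ i))"
    by (rule sum.swap)
  also have "\<dots> = ?S (\<lambda>i j. v $ j * cnj (\<tau> $$ (i, j)) * cnj (v $ i))"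
    by (intro sum.cong refl) (simp add: sym)
  finally have 2: "v \<bullet> map_vec cnj (\<tau> *\<^sub>v v) = ?S (\<lambda>i j. v $ j * cnj (\<tau> $$ (i, j)) * cnj (v $ i))" .
  have pair: "t * x * y - x * cnj t * y = 2 * \<i> * Im t * (x * y)" for t x y
  proof -
    have "t * x * y - x * cnj t * y = (t - cnj t) * (x * y)" by (simp add: algebra_simps)
    then show ?thesis by (simp add: complex_diff_cnj)
  qed
  have diff: "(\<tau> *\<^sub>v v) \<bullet> map_vec cnj v - v \<bullet> map_vec cnj (\<tau> *\<^sub>v v)
      = ?S (\<lambda>i j. 2 * \<i> * Im (\<tau> $$ (i, j)) * (v $ j * cnj (v $ i)))" (is "_ = ?L")
    unfolding 1 2 sum_subtractf[symmetric] by (intro sum.cong refl pair)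
  \<comment> \<open>Exchanging the indices and adding pairs each term with its conjugate, so that
    only real products remain; this is why \<open>2 * ?L\<close> is computed.\<close>
  have "?L = ?S (\<lambda>i j. 2 * \<i> * Im (\<tau> $$ (j, i)) * (v $ i * cnj (v $ j)))"
    by (rule sum.swap)
  also have "\<dots> = ?S (\<lambda>i j. 2 * \<i> * Im (\<tau> $$ (i, j)) * (v $ i * cnj (v $ j)))"
    by (intro sum.cong refl) (simp add: sym)
  finally have "2 * ?L = ?S (\<lambda>i j. 2 * \<i> * Im (\<tau> $$ (i, j)) * (v $ j * cnj (v $ i) + v $ i * cnj (v $ j)))"
    by (simp add: sum.distrib distrib_left)
  also have "\<dots> = ?S (\<lambda>i j. 2 * (2 * \<i> * (complex_of_real (Re (v $ i) * Im (\<tau> $$ (i, j)) * Re (v $ j))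
        + complex_of_real (Im (v $ i) * Im (\<tau> $$ (i, j)) * Im (v $ j)))))"
    by (intro sum.cong refl) (simp add: complex_eq_iff algebra_simps)
  finally have "?L = 2 * \<i> * (?S (\<lambda>i j. complex_of_real (Re (v $ i) * Im (\<tau> $$ (i, j)) * Re (v $ j)))
        + ?S (\<lambda>i j. complex_of_real (Im (v $ i) * Im (\<tau> $$ (i, j)) * Im (v $ j))))"
    by (simp only: sum_distrib_left[symmetric] sum.distrib) simp
  moreover have "quad (map_mat Im \<tau>) x = (\<Sum>i<n. \<Sum>j<n. x $ i * Im (\<tau> $$ (i, j)) * x $ j)" if "x \<in> carrier_vec n" for x
    using that \<tau> by (auto simp: scalar_prod_def sum_distrib_left mult.assoc atLeast0LessThan intro!: sum.cong)
  ultimately show ?thesis unfolding diff using v by simp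
qed

text \<open>
  If \<open>(c\<tau> + d) v = 0\<close>, then \<open>\<gamma>\<close> maps \<open>(\<tau>v, v)\<close> and its conjugate to vectors with vanishing lower half, on
  which the symplectic form is zero. By invariance of the form the conjugate-linear form of \<open>Im \<tau>\<close>
  vanishes at \<open>v\<close>.
\<close>

lemma det_denom_nonzero:
  assumes \<gamma>: "in_Gamma12 n a b c d" and \<tau>: "\<tau> \<in> siegel_space n"
  shows "Determinant.det (denom c d \<tau>) \<noteq> 0"
proof
  have t: "\<tau> \<in> carrier_mat n n" "transpose_mat \<tau> = \<tau>" using \<tau> by (auto simp: siegel_space_def)
  have carrier: "a \<in> carrier_mat n n" "b \<in> carrier_mat n n" "c \<in> carrier_mat n n" "d \<in> carrier_mat n n"
    using \<gamma> by (auto simp: in_Gamma12_def)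
  have D: "denom c d \<tau> \<in> carrier_mat n n" using t carrier by (simp add: denom_def)
  assume "Determinant.det (denom c d \<tau>) = 0"
  then obtain v where v: "v \<in> carrier_vec n" "v \<noteq> 0\<^sub>v n" and Dv: "denom c d \<tau> *\<^sub>v v = 0\<^sub>v n"
    using det_0_iff_vec_prod_zero_field[OF D] by blast
  define y where "y = \<tau> *\<^sub>v v"
  have y: "y \<in> carrier_vec n" using t v by (simp add: y_def)
  have cy: "cmat c *\<^sub>v y + cmat d *\<^sub>v v = 0\<^sub>v n"
    using Dv carrier t v by (simp add: denom_def y_def add_mult_distrib_mat_vec[of _ n n])
  \<comment> \<open>Conjugation fixes \<open>c\<close> and \<open>d\<close>, which have integer
    entries.\<close>
  have cy': "cmat c *\<^sub>v map_vec cnj y + cmat d *\<^sub>v map_vec cnj v = 0\<^sub>v n"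
  proof -
    have "cmat c *\<^sub>v map_vec cnj y + cmat d *\<^sub>v map_vec cnj v = map_vec cnj (cmat c *\<^sub>v y + cmat d *\<^sub>v v)"
      using carrier y v by (intro eq_vecI) (auto simp: scalar_prod_def)
    moreover have "map_vec cnj (0\<^sub>v n) = 0\<^sub>v n" by (rule eq_vecI) auto
    ultimately show ?thesis by (simp add: cy)
  qed
  define \<Gamma> where "\<Gamma> = cmat (four_block_mat a b c d)"
  define J where "J = cmat (symplectic_form n)"
  have \<Gamma>: "\<Gamma> = four_block_mat (cmat a) (cmat b) (cmat c) (cmat d)"
    unfolding \<Gamma>_def by (rule map_four_block_mat) (use carrier in auto)
  have J: "J = four_block_mat (0\<^sub>m n n) (1\<^sub>m n) (- 1\<^sub>m n) (0\<^sub>m n n)"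
    unfolding J_def symplectic_form_def by (subst map_four_block_mat[of _ n n _ n _ n]) (auto intro!: arg_cong4[of _ _ _ _ _ _ _ _ four_block_mat] eq_matI)
  have \<Gamma>c: "\<Gamma> \<in> carrier_mat (n + n) (n + n)"
    unfolding \<Gamma> by (rule four_block_carrier_mat) (use carrier in auto)
  have Jc: "J \<in> carrier_mat (n + n) (n + n)"
    unfolding J by (rule four_block_carrier_mat) auto
  have inv: "transpose_mat \<Gamma> * J * \<Gamma> = J"
  proof -
    let ?g = "four_block_mat a b c d"
    have g: "?g \<in> carrier_mat (n + n) (n + n)" "symplectic_form n \<in> carrier_mat (n + n) (n + n)"
      "transpose_mat ?g * symplectic_form n * ?g = symplectic_form n"
      using \<gamma> by (auto simp: in_Gamma12_def Sp_def mult_2 symplectic_form_def)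
    have gt: "transpose_mat ?g \<in> carrier_mat (n + n) (n + n)" using g by simp
    have "J = cmat (transpose_mat ?g * symplectic_form n) * \<Gamma>"
      unfolding J_def \<Gamma>_def
      by (subst of_int_hom.mat_hom_mult[OF mult_carrier_mat[OF gt g(2)] g(1), symmetric]) (simp only: g(3))
    also have "cmat (transpose_mat ?g * symplectic_form n) = cmat (transpose_mat ?g) * J"
      unfolding J_def by (rule of_int_hom.mat_hom_mult[OF gt g(2)])
    also have "cmat (transpose_mat ?g) = transpose_mat \<Gamma>"
      unfolding \<Gamma>_def by (rule eq_matI) auto
    finally show ?thesis by simp
  qed
  have JX: "J *\<^sub>v (p @\<^sub>v q) = q @\<^sub>v - p" if "p \<in> carrier_vec n" "q \<in> carrier_vec n" for p q
    unfolding J by (subst four_block_mat_mult_append[of _ n n _ n _ n]) (use that in \<open>auto simp: uminus_mult_mat_vec\<close>)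
  define X X' where "X = y @\<^sub>v v" and "X' = map_vec cnj y @\<^sub>v map_vec cnj v"
  have Xc: "X \<in> carrier_vec (n + n)" "X' \<in> carrier_vec (n + n)"
    using y v by (auto simp: X_def X'_def)
  define p p' where "p = cmat a *\<^sub>v y + cmat b *\<^sub>v v" and "p' = cmat a *\<^sub>v map_vec cnj y + cmat b *\<^sub>v map_vec cnj v"
  have pc: "p \<in> carrier_vec n" "p' \<in> carrier_vec n"
    using carrier y v by (auto simp: p_def p'_def)
  have \<Gamma>X: "\<Gamma> *\<^sub>v X = p @\<^sub>v 0\<^sub>v n" "\<Gamma> *\<^sub>v X' = p' @\<^sub>v 0\<^sub>v n"
    unfolding \<Gamma> X_def X'_def
    by (subst four_block_mat_mult_append[of _ n n _ n _ n]; use carrier y v cy cy' in \<open>simp add: p_def p'_def\<close>)+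
  have "X \<bullet> (J *\<^sub>v X') = X \<bullet> (transpose_mat \<Gamma> *\<^sub>v (J *\<^sub>v (\<Gamma> *\<^sub>v X')))"
  proof -
    have "J *\<^sub>v X' = transpose_mat \<Gamma> * J * \<Gamma> *\<^sub>v X'" by (simp only: inv)
    also have "\<dots> = transpose_mat \<Gamma> *\<^sub>v (J *\<^sub>v (\<Gamma> *\<^sub>v X'))"
      using \<Gamma>c Jc Xc by (simp add: assoc_mult_mat_vec[of _ "n + n" "n + n" _ "n + n"])
    finally show ?thesis by simp
  qed
  also have "\<dots> = (\<Gamma> *\<^sub>v X) \<bullet> (J *\<^sub>v (\<Gamma> *\<^sub>v X'))"
  proof -
    have "J *\<^sub>v (\<Gamma> *\<^sub>v X') \<in> carrier_vec (n + n)" using \<Gamma>c Jc Xc by simp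
    then show ?thesis
      using transpose_vec_mult_scalar[of "transpose_mat \<Gamma>" "n + n" "n + n" "J *\<^sub>v (\<Gamma> *\<^sub>v X')" X] \<Gamma>c Xc
      by simp
  qed
  also have "\<dots> = (p @\<^sub>v 0\<^sub>v n) \<bullet> (0\<^sub>v n @\<^sub>v - p')"
    using pc by (simp add: \<Gamma>X JX)
  also have "\<dots> = p \<bullet> 0\<^sub>v n + 0\<^sub>v n \<bullet> - p'"
    using pc by (intro scalar_prod_append[of _ n _ n]) auto
  also have "\<dots> = 0" using pc by simp
  finally have "X \<bullet> (J *\<^sub>v X') = 0" .
  moreover have "X \<bullet> (J *\<^sub>v X') = y \<bullet> map_vec cnj v + v \<bullet> - map_vec cnj y"
    using y v JX[of "map_vec cnj y" "map_vec cnj v"] scalar_prod_append[of y n v n "map_vec cnj v" "- map_vec cnj y"]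
    by (simp add: X_def X'_def)
  ultimately have "y \<bullet> map_vec cnj v - v \<bullet> map_vec cnj y = 0"
    using y v by simp
  then have "complex_of_real (quad (map_mat Im \<tau>) (map_vec Re v) + quad (map_mat Im \<tau>) (map_vec Im v)) = 0"
    unfolding y_def complex_quad_Im[OF t v(1)] by simp
  then have sum: "quad (map_mat Im \<tau>) (map_vec Re v) + quad (map_mat Im \<tau>) (map_vec Im v) = 0"
    by (simp only: of_real_eq_0_iff)
  have pos: "quad (map_mat Im \<tau>) x > 0" if "x \<in> carrier_vec n" "x \<noteq> 0\<^sub>v n" for x
    using \<tau> that by (auto simp: siegel_space_def)
  have zero: "quad (map_mat Im \<tau>) (0\<^sub>v n) = 0"
  proof -
    have "map_mat Im \<tau> *\<^sub>v 0\<^sub>v n \<in> carrier_vec n" using t by simp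
    then show ?thesis by simp
  qed
  have "map_vec Re v = 0\<^sub>v n \<and> map_vec Im v = 0\<^sub>v n"
    using pos[of "map_vec Re v"] pos[of "map_vec Im v"] sum v zero
    by (metis add.right_neutral add_0 add_pos_pos less_irrefl map_carrier_vec)
  then have "v $ i = 0" if "i < n" for i
    using that v by (metis carrier_vecD complex_eq_iff index_map_vec(1) index_zero_vec(1) zero_complex.sel)
  then have "v = 0\<^sub>v n" using v by (intro eq_vecI) auto
  then show False using v by simp
qed

subsection \<open>Transformation of the bordered Hessian\<close>

text \<open>The gradient and Hessian of theta, freed from theta: the transformation lemma relates
  two functions, in the modular case theta at two different period matrices.\<close>

definition grad_vec :: "nat \<Rightarrow> (complex Matrix.vec \<Rightarrow> complex) \<Rightarrow> complex Matrix.vec \<Rightarrow> complex Matrix.vec" where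
  "grad_vec n F z = Matrix.vec n (\<lambda>i. cpartial n i F z)"

definition hess_mat :: "nat \<Rightarrow> (complex Matrix.vec \<Rightarrow> complex) \<Rightarrow> complex Matrix.vec \<Rightarrow> complex Matrix.mat" where
  "hess_mat n F z = Matrix.mat n n (\<lambda>(i, j). cpartial n i (cpartial n j F) z)"

lemma eta_eq:
  "eta n z \<tau> = quad (cofactor_mat (hess_mat n (\<lambda>z. riemann_theta n z \<tau>) z)) (grad_vec n (\<lambda>z. riemann_theta n z \<tau>) z)"
  by (simp add: eta_def theta_hess_def theta_grad_def grad_vec_def hess_mat_def)

lemma grad_vec_eq:
  assumes "has_grad n F G" "z \<in> carrier_vec n"
  shows "grad_vec n F z = Matrix.vec n (\<lambda>i. G i z)"
  unfolding grad_vec_def by (intro eq_vecI) (auto simp: cpartial_eq[OF assms])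

lemma hess_mat_eq:
  assumes F: "has_grad n F G" and G: "\<And>j. j < n \<Longrightarrow> has_grad n (G j) (\<lambda>i. H i j)" and z: "z \<in> carrier_vec n"
  shows "hess_mat n F z = Matrix.mat n n (\<lambda>(i, j). H i j z)"
proof (rule eq_matI)
  fix i j assume "i < dim_row (Matrix.mat n n (\<lambda>(i, j). H i j z))" "j < dim_col (Matrix.mat n n (\<lambda>(i, j). H i j z))"
  then have ij: "i < n" "j < n" by auto
  have "cpartial n i (cpartial n j F) z = cpartial n i (G j) z"
    by (rule cpartial_cong) (use ij z cpartial_eq[OF F] in auto)
  also have "\<dots> = H i j z" by (rule cpartial_eq[OF G]) (use ij z in auto)
  finally show "hess_mat n F z $$ (i, j) = Matrix.mat n n (\<lambda>(i, j). H i j z) $$ (i, j)"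
    using ij by (simp add: hess_mat_def)
qed (simp_all add: hess_mat_def)

text \<open>The law for \<open>F'\<close> is required at all points because it is differentiated
  twice, whereas \<open>F\<close> has to vanish only at \<open>z\<close>. Differentiability of
  \<open>F'\<close> is a consequence of the law, so all analytic input concerns \<open>F\<close> and
  \<open>l\<close>.\<close>

lemma quad_cofactor_hess_transform:
  assumes F: "has_grad n F G" and G: "\<And>j. j < n \<Longrightarrow> has_grad n (G j) (\<lambda>i. H i j)"
    and l: "has_grad n l L" and L: "\<And>j. j < n \<Longrightarrow> has_grad n (L j) (\<lambda>i. M i j)"
    and B: "B \<in> carrier_mat n n" and p: "p \<in> carrier_vec n"
    and F': "\<And>w. w \<in> carrier_vec n \<Longrightarrow> F' w = c * exp (l (B *\<^sub>v w + p)) * F (B *\<^sub>v w + p)"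
    and w: "w \<in> carrier_vec n" and z: "z = B *\<^sub>v w + p" and zero: "F z = 0"
  shows "quad (cofactor_mat (hess_mat n F' w)) (grad_vec n F' w)
    = (c * exp (l z)) ^ (n + 1) * Determinant.det B ^ 2 * quad (cofactor_mat (hess_mat n F z)) (grad_vec n F z)"
proof -
  have zc: "z \<in> carrier_vec n" using B p w by (simp add: z)
  define E where "E z = c * exp (l z)" for z
  have E: "has_grad n E (\<lambda>i z. E z * L i z)"
    by (rule has_grad_cong[OF has_grad_mult[OF has_grad_const[of n c] has_grad_exp[OF l]]]) (simp_all add: E_def)
  define EG where "EG i z = E z * L i z * F z + E z * G i z" for i z
  have EF: "has_grad n (\<lambda>z. E z * F z) EG"
    by (rule has_grad_cong[OF has_grad_mult[OF E F]]) (simp_all add: EG_def)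
  define EH where "EH i j z = (E z * L i z * L j z + E z * M i j z) * F z + E z * L j z * G i z
      + (E z * L i z * G j z + E z * H i j z)" for i j z
  have EH: "has_grad n (EG j) (\<lambda>i. EH i j)" if "j < n" for j
    by (rule has_grad_cong[OF has_grad_add[OF has_grad_mult[OF has_grad_mult[OF E L[OF that]] F] has_grad_mult[OF E G[OF that]]]])
      (simp_all add: EG_def EH_def)
  define G' where "G' i w = (\<Sum>k<n. B $$ (k, i) * EG k (B *\<^sub>v w + p))" for i w
  have F'_grad: "has_grad n F' G'"
    by (rule has_grad_cong[OF has_grad_affine[OF EF B p]]) (simp_all add: F' E_def G'_def)
  define H' where "H' i j w = (\<Sum>k<n. B $$ (k, j) * (\<Sum>m<n. B $$ (m, i) * EH m k (B *\<^sub>v w + p)))" for i j w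
  have G'_grad: "has_grad n (G' j) (\<lambda>i. H' i j)" for j
  proof (rule has_grad_cong)
    show "has_grad n (\<lambda>w. \<Sum>k<n. B $$ (k, j) * EG k (B *\<^sub>v w + p))
      (\<lambda>i w. \<Sum>k<n. 0 * EG k (B *\<^sub>v w + p) + B $$ (k, j) * (\<Sum>m<n. B $$ (m, i) * EH m k (B *\<^sub>v w + p)))"
      by (intro has_grad_sum has_grad_mult has_grad_const has_grad_affine EH B p) auto
  qed (simp_all add: G'_def H'_def)
  define g where "g = grad_vec n F z"
  define K where "K = hess_mat n F z"
  define u where "u = Matrix.vec n (\<lambda>i. L i z)"
  have g: "g = Matrix.vec n (\<lambda>i. G i z)" unfolding g_def by (rule grad_vec_eq[OF F zc])
  have K: "K = Matrix.mat n n (\<lambda>(i, j). H i j z)" unfolding K_def by (rule hess_mat_eq[OF F G zc])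
  define S where "S = K + Matrix.mat n n (\<lambda>(i, j). u $ i * g $ j + g $ i * u $ j)"
  \<comment> \<open>With \<open>F z = 0\<close> the first summand of \<open>EH\<close> disappears,
    and with it both \<open>M\<close> and the products of two derivatives of \<open>l\<close>. The
    two mixed summands form the symmetric correction in \<open>S\<close>.\<close>
  have S: "S \<in> carrier_mat n n" "\<And>i j. i < n \<Longrightarrow> j < n \<Longrightarrow> EH i j z = E z * S $$ (i, j)"
    by (auto simp: S_def K g u_def EH_def zero algebra_simps)
  have grad: "grad_vec n F' w = E z \<cdot>\<^sub>v (transpose_mat B *\<^sub>v g)"
    unfolding grad_vec_eq[OF F'_grad w]
    by (rule eq_vecI)
      (use B in \<open>auto simp: G'_def z[symmetric] EG_def zero g scalar_prod_def sum_distrib_left atLeast0LessThan mult_ac intro!: sum.cong\<close>)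
  have hess: "hess_mat n F' w = E z \<cdot>\<^sub>m (transpose_mat B * S * transpose_mat (transpose_mat B))"
  proof -
    define T where "T = transpose_mat B * S"
    have T: "T \<in> carrier_mat n n" using B S(1) by (simp add: T_def)
    have T_index: "T $$ (i, k) = (\<Sum>m<n. B $$ (m, i) * S $$ (m, k))" if "i < n" "k < n" for i k
      using B S(1) that by (simp add: T_def scalar_prod_def atLeast0LessThan)
    have "(transpose_mat B * S * B) $$ (i, j) = (\<Sum>k<n. (\<Sum>m<n. B $$ (m, i) * S $$ (m, k)) * B $$ (k, j))"
      if "i < n" "j < n" for i j
      unfolding T_def[symmetric] using T B that by (simp add: scalar_prod_def atLeast0LessThan T_index)
    then show ?thesis
      unfolding hess_mat_eq[OF F'_grad G'_grad w]
      by (intro eq_matI)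
        (use B S in \<open>auto simp: H'_def z[symmetric] sum_distrib_left sum_distrib_right mult_ac intro!: sum.cong\<close>)
  qed
  have "quad (cofactor_mat (hess_mat n F' w)) (grad_vec n F' w)
      = E z ^ (n + 1) * Determinant.det (transpose_mat B) ^ 2 * quad (cofactor_mat K) g"
  proof (rule quad_cofactor_transform)
    show "hess_mat n F' w = E z \<cdot>\<^sub>m (transpose_mat B *
        (K + Matrix.mat n n (\<lambda>(i, j). u $ i * g $ j + g $ i * u $ j)) * transpose_mat (transpose_mat B))"
      using hess unfolding S_def .
  qed (use B grad in \<open>simp_all add: K g u_def\<close>)
  then show ?thesis by (simp only: det_transpose[OF B] E_def K_def g_def)
qed

section \<open>Gradients of the linear and quadratic exponents\<close>

lemma has_grad_linear:
  assumes "b \<in> carrier_vec n"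
  shows "has_grad n (\<lambda>z. b \<bullet> z) (\<lambda>i z. b $ i)"
  unfolding has_grad_def
proof safe
  fix z v :: "complex Matrix.vec" assume zv: "z \<in> carrier_vec n" "v \<in> carrier_vec n"
  have "((\<lambda>t. b \<bullet> z + t * (b \<bullet> v)) has_field_derivative b \<bullet> v) (at 0)"
    by (auto intro!: derivative_eq_intros)
  moreover have "b \<bullet> (z + t \<cdot>\<^sub>v v) = b \<bullet> z + t * (b \<bullet> v)" for t
    using zv assms by (simp add: scalar_prod_add_distrib[of _ n])
  moreover have "b \<bullet> v = (\<Sum>i<n. v $ i * b $ i)"
    using zv by (simp add: scalar_prod_def atLeast0LessThan mult.commute)
  ultimately show "((\<lambda>t. b \<bullet> (z + t \<cdot>\<^sub>v v)) has_field_derivative (\<Sum>i<n. v $ i * b $ i)) (at 0)" by simp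
qed

text \<open>Along a line the form is an explicit polynomial of degree two in \<open>t\<close>. Both
  \<open>N\<close> and its transpose occur as \<open>N\<close> is arbitrary; symmetry of
  \<open>(c\<tau> + d)^-1 c\<close> thus never has to be established.\<close>

lemma has_grad_quad:
  assumes N: "N \<in> carrier_mat n n"
  shows "has_grad n (\<lambda>z. quad N z) (\<lambda>i z. (N *\<^sub>v z) $ i + (transpose_mat N *\<^sub>v z) $ i)"
  unfolding has_grad_def
proof safe
  fix z v :: "complex Matrix.vec" assume zv: "z \<in> carrier_vec n" "v \<in> carrier_vec n"
  have "((\<lambda>t. quad N z + t * (v \<bullet> (N *\<^sub>v z) + z \<bullet> (N *\<^sub>v v)) + t ^ 2 * quad N v)
      has_field_derivative v \<bullet> (N *\<^sub>v z) + z \<bullet> (N *\<^sub>v v)) (at 0)"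
    by (auto intro!: derivative_eq_intros)
  moreover have "quad N (z + t \<cdot>\<^sub>v v) = quad N z + t * (v \<bullet> (N *\<^sub>v z) + z \<bullet> (N *\<^sub>v v)) + t ^ 2 * quad N v" for t
  proof -
    have "N *\<^sub>v (z + t \<cdot>\<^sub>v v) = N *\<^sub>v z + t \<cdot>\<^sub>v (N *\<^sub>v v)"
      using N zv by (simp add: mult_add_distrib_mat_vec[of _ n n] mult_mat_vec[of _ n n])
    then show ?thesis
      using N zv by (simp add: scalar_prod_add_distrib[of _ n] add_scalar_prod_distrib[of _ n] algebra_simps power2_eq_square)
  qed
  moreover have "v \<bullet> (N *\<^sub>v z) + z \<bullet> (N *\<^sub>v v) = (\<Sum>i<n. v $ i * ((N *\<^sub>v z) $ i + (transpose_mat N *\<^sub>v z) $ i))"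
  proof -
    have "z \<bullet> (N *\<^sub>v v) = v \<bullet> (transpose_mat N *\<^sub>v z)"
      using transpose_vec_mult_scalar[OF N zv(2,1)] comm_scalar_prod[of "transpose_mat N *\<^sub>v z" n v] N zv by simp
    then show ?thesis
      using N zv by (simp add: scalar_prod_def[of v] atLeast0LessThan distrib_left sum.distrib)
  qed
  ultimately show "((\<lambda>t. quad N (z + t \<cdot>\<^sub>v v)) has_field_derivative
      (\<Sum>i<n. v $ i * ((N *\<^sub>v z) $ i + (transpose_mat N *\<^sub>v z) $ i))) (at 0)" by simp
qed

lemma has_grad_mat_vec:
  assumes "N \<in> carrier_mat n n" "j < n"
  shows "has_grad n (\<lambda>z. (N *\<^sub>v z) $ j) (\<lambda>i z. N $$ (j, i))"
  by (rule has_grad_cong[OF has_grad_linear[of "row N j"]]) (use assms in auto)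

subsection \<open>Holomorphy\<close>

lemma holomorphic_Cn_cong:
  assumes "holomorphic_Cn n F" "\<And>z. z \<in> carrier_vec n \<Longrightarrow> F' z = F z"
  shows "holomorphic_Cn n F'"
  using assms by (simp add: holomorphic_Cn_def)

lemma holomorphic_Cn_const: "holomorphic_Cn n (\<lambda>z. c)"
  by (simp add: holomorphic_Cn_def)

lemma holomorphic_Cn_mult:
  assumes "holomorphic_Cn n F" "holomorphic_Cn n F'"
  shows "holomorphic_Cn n (\<lambda>z. F z * F' z)"
  using assms by (auto simp: holomorphic_Cn_def intro!: continuous_on_mult holomorphic_on_mult)

lemma holomorphic_Cn_sum:
  assumes "\<And>k. k \<in> I \<Longrightarrow> holomorphic_Cn n (F k)"
  shows "holomorphic_Cn n (\<lambda>z. \<Sum>k\<in>I. F k z)"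
  using assms by (auto simp: holomorphic_Cn_def intro!: continuous_on_sum holomorphic_on_sum)

lemma holomorphic_Cn_prod:
  assumes "\<And>k. k \<in> I \<Longrightarrow> holomorphic_Cn n (F k)"
  shows "holomorphic_Cn n (\<lambda>z. \<Prod>k\<in>I. F k z)"
  using assms by (auto simp: holomorphic_Cn_def intro!: continuous_on_prod holomorphic_on_prod)

text \<open>By the Leibniz formula the determinant is a polynomial in the entries.\<close>

lemma holomorphic_Cn_det:
  assumes A: "\<And>z. z \<in> carrier_vec n \<Longrightarrow> A z \<in> carrier_mat k k"
    and entry: "\<And>i j. i < k \<Longrightarrow> j < k \<Longrightarrow> holomorphic_Cn n (\<lambda>z. A z $$ (i, j))"
  shows "holomorphic_Cn n (\<lambda>z. Determinant.det (A z))"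
proof (rule holomorphic_Cn_cong)
  have "holomorphic_Cn n (\<lambda>z. A z $$ (i, p i))" if "p permutes {0..<k}" "i \<in> {0..<k}" for p i
    using entry[of i "p i"] permutes_in_image[OF that(1), of i] that(2) by simp
  then show "holomorphic_Cn n (\<lambda>z. \<Sum>p | p permutes {0..<k}. signof p * (\<Prod>i = 0..<k. A z $$ (i, p i)))"
    by (intro holomorphic_Cn_sum holomorphic_Cn_mult holomorphic_Cn_const holomorphic_Cn_prod) blast
  show "Determinant.det (A z) = (\<Sum>p | p permutes {0..<k}. signof p * (\<Prod>i = 0..<k. A z $$ (i, p i)))"
    if "z \<in> carrier_vec n" for z
    using det_def'[OF A[OF that]] by simp
qed

lemma holomorphic_Cn_fourier:
  assumes "rapidly_decreasing n p"
  shows "holomorphic_Cn n (fourier n p)"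
  unfolding holomorphic_Cn_def
  using continuous_on_fourier[OF assms] has_grad_holomorphic[OF has_grad_fourier[OF assms]] by simp

text \<open>The bordered determinant serves a second time: its entries are Fourier series or zero,
  so continuity and holomorphy follow on all of \<open>C^n\<close> without a separate study of the
  cofactors. The section on the divisor is the restriction to the zero locus.\<close>

lemma holomorphic_Cn_eta:
  assumes \<tau>: "\<tau> \<in> siegel_space n"
  shows "holomorphic_Cn n (\<lambda>z. eta n z \<tau>)"
proof -
  let ?p = "theta_coeff \<tau>"
  have p: "rapidly_decreasing n ?p" by (rule rapidly_decreasing_theta_coeff[OF \<tau>])
  have p1: "rapidly_decreasing n (fourier_deriv i ?p)" if "i < n" for i
    by (rule rapidly_decreasing_fourier_deriv[OF p that])
  have p2: "rapidly_decreasing n (fourier_deriv i (fourier_deriv j ?p))" if "i < n" "j < n" for i j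
    by (rule rapidly_decreasing_fourier_deriv[OF p1[OF that(2)] that(1)])
  define A where "A z = bordered (Matrix.mat n n (\<lambda>(i, j). fourier n (fourier_deriv i (fourier_deriv j ?p)) z))
      (mat_of_cols n [Matrix.vec n (\<lambda>i. fourier n (fourier_deriv i ?p) z)])" for z
  have A: "A z \<in> carrier_mat (Suc n) (Suc n)" for z
    unfolding A_def by (rule bordered_carrier[OF _ col_mat_carrier]) simp
  have "A z $$ (i, j) = (if i < n then if j < n then fourier n (fourier_deriv i (fourier_deriv j ?p)) z
      else fourier n (fourier_deriv i ?p) z else if j < n then fourier n (fourier_deriv j ?p) z else 0)"
    if "i < Suc n" "j < Suc n" for z i j
    using that by (auto simp: A_def bordered_def mat_of_cols_index)
  then have "holomorphic_Cn n (\<lambda>z. A z $$ (i, j))" if "i < Suc n" "j < Suc n" for i j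
    using that holomorphic_Cn_fourier[OF p1] holomorphic_Cn_fourier[OF p2] holomorphic_Cn_const
    by (cases "i < n"; cases "j < n") simp_all
  then have hol: "holomorphic_Cn n (\<lambda>z. - 1 * Determinant.det (A z))"
    by (intro holomorphic_Cn_mult holomorphic_Cn_const holomorphic_Cn_det[OF A])
  show ?thesis
  proof (rule holomorphic_Cn_cong[OF hol])
    fix z :: "complex Matrix.vec" assume z: "z \<in> carrier_vec n"
    show "eta n z \<tau> = - 1 * Determinant.det (A z)"
      unfolding eta_eq riemann_theta_eq_fourier A_def
      by (subst det_bordered)
        (simp_all add: grad_vec_eq[OF has_grad_fourier[OF p] z]
          hess_mat_eq[OF has_grad_fourier[OF p] has_grad_fourier[OF p1] z])
  qed
qed

subsection \<open>The transformation laws\<close>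

text \<open>Here \<open>F\<close> and \<open>F'\<close> are the same function, \<open>B\<close> is
  the identity and the exponent is affine, so its gradient is constant and the determinant
  contributes nothing.\<close>

lemma eta_quasi_periodic:
  assumes \<tau>: "\<tau> \<in> siegel_space n" and u: "u \<in> carrier_vec n" and v: "v \<in> carrier_vec n"
    and z: "z \<in> carrier_vec n" and zero: "riemann_theta n z \<tau> = 0"
  shows "eta n (z + \<tau> *\<^sub>v cvec u + cvec v) \<tau> =
    exp (- (pi * \<i> * quad \<tau> (cvec u)) - 2 * pi * \<i> * (cvec u \<bullet> z)) ^ (n + 1) * eta n z \<tau>"
proof -
  have t: "\<tau> \<in> carrier_mat n n" using \<tau> by (simp add: siegel_space_def)
  have p: "rapidly_decreasing n (theta_coeff \<tau>)" by (rule rapidly_decreasing_theta_coeff[OF \<tau>])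
  have p1: "rapidly_decreasing n (fourier_deriv i (theta_coeff \<tau>))" if "i < n" for i
    by (rule rapidly_decreasing_fourier_deriv[OF p that])
  define q where "q = \<tau> *\<^sub>v cvec u + cvec v"
  have q: "q \<in> carrier_vec n" using t u v by (simp add: q_def)
  define w where "w = z + \<tau> *\<^sub>v cvec u + cvec v"
  have w: "w \<in> carrier_vec n" using t u v z by (simp add: w_def)
  define l where "l z = - (pi * \<i> * quad \<tau> (cvec u)) + (- 2 * pi * \<i>) * (cvec u \<bullet> z)" for z
  \<comment> \<open>The gradients keep the shape the product rule gives them; each
    \<open>0 *\<close> is the derivative of a constant factor.\<close>
  have l: "has_grad n l (\<lambda>i z. 0 + (0 * (cvec u \<bullet> z) + (- 2 * pi * \<i>) * cvec u $ i))"
    unfolding l_def by (intro has_grad_add has_grad_mult has_grad_const has_grad_linear) (use u in auto)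
  have L: "has_grad n (\<lambda>z. 0 + (0 * (cvec u \<bullet> z) + (- 2 * pi * \<i>) * cvec u $ j)) (\<lambda>i z. 0)" for j
    by (rule has_grad_cong[OF has_grad_const[of n "- 2 * pi * \<i> * cvec u $ j"]]) auto
  \<comment> \<open>The general lemma expresses \<open>F'\<close> at the new point through
    \<open>F\<close> at the old one, hence the substitution is translation by
    \<open>- q\<close>.\<close>
  have shift: "1\<^sub>m n *\<^sub>v x + - q \<in> carrier_vec n" "1\<^sub>m n *\<^sub>v x + - q + \<tau> *\<^sub>v cvec u + cvec v = x"
    if "x \<in> carrier_vec n" for x
    using that t u v by (auto simp: q_def intro!: eq_vecI)
  have "quad (cofactor_mat (hess_mat n (\<lambda>z. riemann_theta n z \<tau>) w)) (grad_vec n (\<lambda>z. riemann_theta n z \<tau>) w)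
    = (1 * exp (l z)) ^ (n + 1) * Determinant.det (1\<^sub>m n) ^ 2 *
      quad (cofactor_mat (hess_mat n (\<lambda>z. riemann_theta n z \<tau>) z)) (grad_vec n (\<lambda>z. riemann_theta n z \<tau>) z)"
  proof (rule quad_cofactor_hess_transform[where p = "- q" and l = l])
    show "has_grad n (\<lambda>z. riemann_theta n z \<tau>) (\<lambda>i. fourier n (fourier_deriv i (theta_coeff \<tau>)))"
      unfolding riemann_theta_eq_fourier by (rule has_grad_fourier[OF p])
    show "has_grad n (fourier n (fourier_deriv j (theta_coeff \<tau>)))
        (\<lambda>i. fourier n (fourier_deriv i (fourier_deriv j (theta_coeff \<tau>))))" if "j < n" for j
      by (rule has_grad_fourier[OF p1[OF that]])
    show "has_grad n l (\<lambda>i z. 0 + (0 * (cvec u \<bullet> z) + (- 2 * pi * \<i>) * cvec u $ i))" by (rule l)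
    show "has_grad n (\<lambda>z. 0 + (0 * (cvec u \<bullet> z) + (- 2 * pi * \<i>) * cvec u $ j)) (\<lambda>i z. 0)" for j by (rule L)
    show "riemann_theta n x \<tau> = 1 * exp (l (1\<^sub>m n *\<^sub>v x + - q)) * riemann_theta n (1\<^sub>m n *\<^sub>v x + - q) \<tau>"
      if "x \<in> carrier_vec n" for x
      using riemann_theta_quasi_periodic[OF \<tau> u v shift(1)[OF that]] shift(2)[OF that] by (simp add: l_def)
    show "z = 1\<^sub>m n *\<^sub>v w + - q"
      using t u v z w by (auto simp: w_def q_def intro!: eq_vecI)
  qed (use q w zero in auto)
  then show ?thesis unfolding eta_eq w_def[symmetric] by (simp add: l_def)
qed

text \<open>Only theta at \<open>\<tau>\<close> is differentiated as a series. The derivatives at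
  the transformed matrix come from the law itself, so it need not be shown that
  \<open>act_tau\<close> stays in the Siegel space.\<close>

lemma eta_modular:
  assumes \<gamma>: "in_Gamma12 n a b c d" and s: "sqrt_branch n c d s" and mult: "theta_multiplier n a b c d s \<zeta>"
    and \<tau>: "\<tau> \<in> siegel_space n" and z: "z \<in> carrier_vec n" and zero: "riemann_theta n z \<tau> = 0"
  shows "eta n (act_z c d z \<tau>) (act_tau a b c d \<tau>) =
    \<zeta> ^ (n + 1) * s \<tau> ^ (n + 5) * exp_factor c d z \<tau> ^ (n + 1) * eta n z \<tau>"
proof -
  have t: "\<tau> \<in> carrier_mat n n" using \<tau> by (simp add: siegel_space_def)
  have p: "rapidly_decreasing n (theta_coeff \<tau>)" by (rule rapidly_decreasing_theta_coeff[OF \<tau>])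
  have p1: "rapidly_decreasing n (fourier_deriv i (theta_coeff \<tau>))" if "i < n" for i
    by (rule rapidly_decreasing_fourier_deriv[OF p that])
  let ?D = "denom c d \<tau>"
  have cd: "c \<in> carrier_mat n n" "d \<in> carrier_mat n n" using \<gamma> by (auto simp: in_Gamma12_def)
  have D: "?D \<in> carrier_mat n n" using t cd by (simp add: denom_def)
  obtain V where "mat_inverse ?D = Some V" and V: "V \<in> carrier_mat n n" "?D * V = 1\<^sub>m n" "V * ?D = 1\<^sub>m n"
    by (rule det_nonzero_inverse[OF D det_denom_nonzero[OF \<gamma> \<tau>]])
  then have inv: "mat_inv ?D = V" by (simp add: mat_inv_def)
  \<comment> \<open>The action on \<open>z\<close> is inverted by the transpose of
    \<open>c\<tau> + d\<close>, which becomes the matrix \<open>B\<close> of the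
    substitution.\<close>
  have VD: "transpose_mat V *\<^sub>v (transpose_mat ?D *\<^sub>v x) = x" "transpose_mat ?D *\<^sub>v (transpose_mat V *\<^sub>v x) = x"
    if x: "x \<in> carrier_vec n" for x
  proof -
    have "transpose_mat V * transpose_mat ?D = 1\<^sub>m n" "transpose_mat ?D * transpose_mat V = 1\<^sub>m n"
      by (simp_all add: transpose_mult[OF D V(1), symmetric] transpose_mult[OF V(1) D, symmetric] V(2,3))
    then show "transpose_mat V *\<^sub>v (transpose_mat ?D *\<^sub>v x) = x" "transpose_mat ?D *\<^sub>v (transpose_mat V *\<^sub>v x) = x"
      using D V(1) x assoc_mult_mat_vec[of "transpose_mat V" n n "transpose_mat ?D" n x]
        assoc_mult_mat_vec[of "transpose_mat ?D" n n "transpose_mat V" n x] by simp_all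
  qed
  define N where "N = V * cmat c"
  have N: "N \<in> carrier_mat n n" using V(1) cd by (simp add: N_def)
  define l where "l z = pi * \<i> * quad N z" for z
  have exp_l: "exp_factor c d x \<tau> = exp (l x)" for x
    by (simp add: exp_factor_def inv l_def N_def)
  define L where "L i z = 0 * quad N z + pi * \<i> * ((N *\<^sub>v z) $ i + (transpose_mat N *\<^sub>v z) $ i)" for i z
  have l: "has_grad n l L"
    unfolding l_def L_def by (intro has_grad_mult has_grad_const has_grad_quad N)
  have L: "has_grad n (L j) (\<lambda>i z. 0 * ((N *\<^sub>v z) $ j + (transpose_mat N *\<^sub>v z) $ j)
      + pi * \<i> * (N $$ (j, i) + transpose_mat N $$ (j, i)))" if "j < n" for j
  proof -
    have "has_grad n (\<lambda>z. pi * \<i> * ((N *\<^sub>v z) $ j + (transpose_mat N *\<^sub>v z) $ j))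
        (\<lambda>i z. 0 * ((N *\<^sub>v z) $ j + (transpose_mat N *\<^sub>v z) $ j) + pi * \<i> * (N $$ (j, i) + transpose_mat N $$ (j, i)))"
      by (intro has_grad_mult has_grad_const has_grad_add has_grad_mat_vec) (use N that in auto)
    then show ?thesis by (rule has_grad_cong) (simp_all add: L_def)
  qed
  let ?\<tau>' = "act_tau a b c d \<tau>"
  define w where "w = act_z c d z \<tau>"
  have w_eq: "w = transpose_mat V *\<^sub>v z" by (simp add: w_def act_z_def inv)
  have w: "w \<in> carrier_vec n" using V(1) z by (simp add: w_eq)
  have "quad (cofactor_mat (hess_mat n (\<lambda>z. riemann_theta n z ?\<tau>') w)) (grad_vec n (\<lambda>z. riemann_theta n z ?\<tau>') w)
    = (\<zeta> * s \<tau> * exp (l z)) ^ (n + 1) * Determinant.det (transpose_mat ?D) ^ 2 *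
      quad (cofactor_mat (hess_mat n (\<lambda>z. riemann_theta n z \<tau>) z)) (grad_vec n (\<lambda>z. riemann_theta n z \<tau>) z)"
  proof (rule quad_cofactor_hess_transform[where p = "0\<^sub>v n" and l = l])
    show "has_grad n (\<lambda>z. riemann_theta n z \<tau>) (\<lambda>i. fourier n (fourier_deriv i (theta_coeff \<tau>)))"
      unfolding riemann_theta_eq_fourier by (rule has_grad_fourier[OF p])
    show "has_grad n (fourier n (fourier_deriv j (theta_coeff \<tau>)))
        (\<lambda>i. fourier n (fourier_deriv i (fourier_deriv j (theta_coeff \<tau>))))" if "j < n" for j
      by (rule has_grad_fourier[OF p1[OF that]])
    show "has_grad n l L" by (rule l)
    show "riemann_theta n x ?\<tau>' = \<zeta> * s \<tau> * exp (l (transpose_mat ?D *\<^sub>v x + 0\<^sub>v n)) *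
        riemann_theta n (transpose_mat ?D *\<^sub>v x + 0\<^sub>v n) \<tau>" if x: "x \<in> carrier_vec n" for x
    proof -
      have Dx: "transpose_mat ?D *\<^sub>v x \<in> carrier_vec n" using D x by simp
      \<comment> \<open>The law is applied at the preimage of \<open>x\<close>, which turns it into
        a formula for theta at an arbitrary new point.\<close>
      have "riemann_theta n (act_z c d (transpose_mat ?D *\<^sub>v x) \<tau>) ?\<tau>' =
          \<zeta> * s \<tau> * exp_factor c d (transpose_mat ?D *\<^sub>v x) \<tau> * riemann_theta n (transpose_mat ?D *\<^sub>v x) \<tau>"
        using mult Dx \<tau> by (simp add: theta_multiplier_def)
      moreover have "act_z c d (transpose_mat ?D *\<^sub>v x) \<tau> = x"
        by (simp add: act_z_def inv VD[OF x])
      ultimately show ?thesis using Dx by (simp add: exp_l)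
    qed
    show "z = transpose_mat ?D *\<^sub>v w + 0\<^sub>v n" using VD(2)[OF z] z by (simp add: w_eq)
  qed (use L D w zero in auto)
  then have "eta n w ?\<tau>' = (\<zeta> * s \<tau> * exp (l z)) ^ (n + 1) * Determinant.det ?D ^ 2 * eta n z \<tau>"
    unfolding eta_eq by (simp only: det_transpose[OF D])
  moreover have "Determinant.det ?D = s \<tau> ^ 2" using s \<tau> by (simp add: sqrt_branch_def)
  \<comment> \<open>One power of \<open>s \<tau>\<close> for each of the \<open>n + 1\<close> theta
    factors, and four from the squared determinant, itself the square of
    \<open>s \<tau>\<close>.\<close>
  moreover have "s \<tau> ^ (n + 5) = s \<tau> ^ (n + 1) * (s \<tau> ^ 2) ^ 2"
    by (simp only: power_mult[symmetric] power_add[symmetric]) (simp add: add.commute)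
  ultimately show ?thesis by (simp add: w_def exp_l power_mult_distrib mult_ac del: power_Suc)
qed

theorem theorem1p3:
  fixes n :: nat
  assumes "n \<ge> 1"
  shows "(\<forall>\<tau> \<in> siegel_space n.
            holomorphic_Cn n (\<lambda>z. eta n z \<tau>) \<and>
            (\<forall>u \<in> carrier_vec n. \<forall>v \<in> carrier_vec n. \<forall>z \<in> carrier_vec n.
               riemann_theta n z \<tau> = 0 \<longrightarrow>
               eta n (z + \<tau> *\<^sub>v cvec u + cvec v) \<tau> =
                 exp (- (pi * \<i> * quad \<tau> (cvec u)) - 2 * pi * \<i> * (cvec u \<bullet> z)) ^ (n + 1) * eta n z \<tau>))
       \<and> (\<forall>a b c d s \<zeta>.
            in_Gamma12 n a b c d \<longrightarrow> sqrt_branch n c d s \<longrightarrow> theta_multiplier n a b c d s \<zeta> \<longrightarrow>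
            (\<forall>z \<in> carrier_vec n. \<forall>\<tau> \<in> siegel_space n.
               riemann_theta n z \<tau> = 0 \<longrightarrow>
               eta n (act_z c d z \<tau>) (act_tau a b c d \<tau>) =
                 \<zeta> ^ (n + 1) * s \<tau> ^ (n + 5) * exp_factor c d z \<tau> ^ (n + 1) * eta n z \<tau>))"
  using holomorphic_Cn_eta eta_quasi_periodic eta_modular by blast

end
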